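(* Let $M$ be a smooth $n$-manifold with a fixed smooth inner product (Riemannian metric) $g$ on $TM$, and let $B\in \mathrm{Aut}(\Gamma(TM))$ be orthogonal. Then $$L_B=\{((I+B)X,\,(I-B)\omega_X)\;:\;X\in\Gamma(TM)\}$$ is (the module of sections of) a Dirac structure on $TM$.
   Context: $\Gamma$ denotes smooth sections. The inner product $g$ identifies $TM$ with $T^*M$: for $X\in\Gamma(TM)$, $\omega_X\in\Gamma(T^*M)$ is the dual form $\omega_X=g(X,\cdot)$, and for $\omega\in\Gamma(T^*M)$, $X_\omega\in\Gamma(TM)$ is the vector field with $g(X_\omega,\cdot)=\omega$. $\mathrm{Aut}(\Gamma(TM))$ is the group of automorphisms of $\Gamma(TM)$ as a module over $C^\infty(M)$, i.e. those induced by vector bundle automorphisms of $TM$ covering the identity of $M$. $B$ is orthogonal if $g(BX,BY)=g(X,Y)$ for all $X,Y$. Via the identification, $B$ acts also on $\Gamma(T^*M)$ by $B\omega_X=\omega_{BX}$. A Dirac structure on $TM$ is a smooth subbundle $L\subset TM\oplus T^*M$ that is maximally isotropic (each fibre is a maximal isotropic subspace) under the pairing $\langle (X,\omega),(Y,\mu)\rangle_+=\frac12(\mu(X)+\omega(Y))$. A subbundle is identified with its module of sections. *)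

theory Defs
  imports "HOL-Analysis.Analysis" "HOL-Library.Function_Algebras"
begin

instantiation "fun" :: (type, real_vector) real_vector
begin

definition scaleR_fun :: "real \<Rightarrow> ('a \<Rightarrow> 'b) \<Rightarrow> 'a \<Rightarrow> 'b" where
  "scaleR_fun r f = (\<lambda>x. r *\<^sub>R f x)"

instance
  by standard (auto simp: scaleR_fun_def plus_fun_def fun_eq_iff scaleR_add_right scaleR_add_left)

end

text \<open>Meant for open \<open>S\<close> and a finite-dimensional domain, where it is the usual notion of
  \<open>C\<^sup>k\<close>: \<open>f\<close> is differentiable and all its directional derivatives are \<open>C\<^sup>k\<^sup>-\<^sup>1\<close>.\<close>

primrec Ck_on ::
  "nat \<Rightarrow> 'e::real_normed_vector set \<Rightarrow> ('e \<Rightarrow> 'f::real_normed_vector) \<Rightarrow> bool" where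
  "Ck_on 0 S f \<longleftrightarrow> continuous_on S f"
| "Ck_on (Suc k) S f \<longleftrightarrow> (\<forall>x\<in>S. f differentiable (at x)) \<and>
     (\<forall>u. Ck_on k S (\<lambda>x. frechet_derivative f (at x) u))"

definition smooth_on :: "'e::real_normed_vector set \<Rightarrow> ('e \<Rightarrow> 'f::real_normed_vector) \<Rightarrow> bool" where
  "smooth_on S f \<longleftrightarrow> (\<forall>k. Ck_on k S f)"

text \<open>A chart is a pair of its domain and its coordinate map; the values of the coordinate map
  off the domain are irrelevant.\<close>

type_synonym ('a, 'e) chart = "'a set \<times> ('a \<Rightarrow> 'e)"

definition chart_inv :: "('a, 'e) chart \<Rightarrow> 'e \<Rightarrow> 'a" where
  "chart_inv c = inv_into (fst c) (snd c)"

text \<open>The model space \<open>'e\<close> is an arbitrary real inner product space having a basis of \<open>n\<close> vectors,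
  i.e. a copy of \<open>\<real>\<^sup>n\<close>. Class \<^class>\<open>euclidean_space\<close> is not used because it excludes \<open>n = 0\<close>.
  The atlas need not be maximal: all notions below give the same result for an atlas
  as for the maximal atlas containing it.\<close>

definition smooth_manifold ::
  "nat \<Rightarrow> 'a topology \<Rightarrow> ('a, 'e::real_inner) chart set \<Rightarrow> bool" where
  "smooth_manifold n M A \<longleftrightarrow>
     (\<exists>b::'e set. finite b \<and> card b = n \<and> independent b \<and> span b = UNIV) \<and>
     Hausdorff_space M \<and> second_countable M \<and>
     (\<Union>c\<in>A. fst c) = topspace M \<and>
     (\<forall>c\<in>A. openin M (fst c) \<and> open (snd c ` fst c) \<and>
        homeomorphic_map (subtopology M (fst c)) (top_of_set (snd c ` fst c)) (snd c)) \<and>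
     (\<forall>c\<in>A. \<forall>d\<in>A. smooth_on (snd c ` (fst c \<inter> fst d)) (snd d \<circ> chart_inv c))"

definition smooth_functions :: "('a, 'e::real_inner) chart set \<Rightarrow> 'a set \<Rightarrow> ('a \<Rightarrow> real) set" where
  "smooth_functions A W =
     {f. \<forall>c\<in>A. smooth_on (snd c ` (fst c \<inter> W)) (f \<circ> chart_inv c)}"

text \<open>A tangent vector at \<open>p\<close> is given by its components in every chart around \<open>p\<close>, where the
  components in two charts are related by the derivative of the change of coordinates.
  The component is set to \<open>0\<close> at every other pair \<open>c\<close>. In particular, the tangent
  space at a point not covered by the atlas is \<open>{0}\<close>.\<close>

type_synonym ('a, 'e) tvec = "('a, 'e) chart \<Rightarrow> 'e"
type_synonym ('a, 'e) cvec = "('a, 'e) tvec \<Rightarrow> real"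

definition tangent_space :: "('a, 'e::real_inner) chart set \<Rightarrow> 'a \<Rightarrow> ('a, 'e) tvec set" where
  "tangent_space A p = {v.
     (\<forall>c. c \<notin> A \<or> p \<notin> fst c \<longrightarrow> v c = 0) \<and>
     (\<forall>c\<in>A. \<forall>d\<in>A. p \<in> fst c \<inter> fst d \<longrightarrow>
        v d = frechet_derivative (snd d \<circ> chart_inv c) (at (snd c p)) (v c))}"

text \<open>The tangent vector at \<open>p\<close> with components \<open>u\<close> in the chart \<open>c\<close>.\<close>

definition coord_vector ::
  "('a, 'e::real_inner) chart set \<Rightarrow> ('a, 'e) chart \<Rightarrow> 'e \<Rightarrow> 'a \<Rightarrow> ('a, 'e) tvec" where
  "coord_vector A c u p = (\<lambda>d. if d \<in> A \<and> p \<in> fst d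
     then frechet_derivative (snd d \<circ> chart_inv c) (at (snd c p)) u else 0)"

text \<open>Linear functionals on the tangent space, extended by \<open>0\<close> to all of the type.\<close>

definition cotangent_space :: "('a, 'e::real_inner) chart set \<Rightarrow> 'a \<Rightarrow> ('a, 'e) cvec set" where
  "cotangent_space A p = {\<alpha>.
     (\<forall>v\<in>tangent_space A p. \<forall>w\<in>tangent_space A p. \<alpha> (v + w) = \<alpha> v + \<alpha> w) \<and>
     (\<forall>v\<in>tangent_space A p. \<forall>r. \<alpha> (r *\<^sub>R v) = r * \<alpha> v) \<and>
     (\<forall>v. v \<notin> tangent_space A p \<longrightarrow> \<alpha> v = 0)}"

text \<open>Sections over an open set \<open>W\<close>, extended by \<open>0\<close> off \<open>W\<close>.
  Global sections are those over \<^term>\<open>topspace M\<close>.\<close>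

definition vector_fields ::
  "('a, 'e::real_inner) chart set \<Rightarrow> 'a set \<Rightarrow> ('a \<Rightarrow> ('a, 'e) tvec) set" where
  "vector_fields A W = {X.
     (\<forall>p\<in>W. X p \<in> tangent_space A p) \<and> (\<forall>p. p \<notin> W \<longrightarrow> X p = 0) \<and>
     (\<forall>c\<in>A. smooth_on (snd c ` (fst c \<inter> W)) (\<lambda>x. X (chart_inv c x) c))}"

definition one_forms ::
  "('a, 'e::real_inner) chart set \<Rightarrow> 'a set \<Rightarrow> ('a \<Rightarrow> ('a, 'e) cvec) set" where
  "one_forms A W = {\<omega>.
     (\<forall>p\<in>W. \<omega> p \<in> cotangent_space A p) \<and> (\<forall>p. p \<notin> W \<longrightarrow> \<omega> p = 0) \<and>
     (\<forall>c\<in>A. \<forall>u. smooth_on (snd c ` (fst c \<inter> W))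
        (\<lambda>x. \<omega> (chart_inv c x) (coord_vector A c u (chart_inv c x))))}"

definition riemannian_metric ::
  "'a topology \<Rightarrow> ('a, 'e::real_inner) chart set \<Rightarrow>
   ('a \<Rightarrow> ('a, 'e) tvec \<Rightarrow> ('a, 'e) tvec \<Rightarrow> real) \<Rightarrow> bool" where
  "riemannian_metric M A g \<longleftrightarrow>
     (\<forall>p\<in>topspace M. \<forall>u\<in>tangent_space A p. \<forall>v\<in>tangent_space A p.
        g p u v = g p v u \<and>
        (\<forall>w\<in>tangent_space A p. g p (u + v) w = g p u w + g p v w) \<and>
        (\<forall>r. g p (r *\<^sub>R u) v = r * g p u v) \<and>
        (u \<noteq> 0 \<longrightarrow> g p u u > 0)) \<and>
     (\<forall>c\<in>A. \<forall>u v. smooth_on (snd c ` fst c)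
        (\<lambda>x. g (chart_inv c x) (coord_vector A c u (chart_inv c x))
                                (coord_vector A c v (chart_inv c x))))"

text \<open>\<^term>\<open>flat M A g X\<close> is \<open>\<omega>\<^sub>X = g(X, \<cdot>)\<close>, and \<^term>\<open>sharp M A g \<omega>\<close> is \<open>X\<^sub>\<omega>\<close>.\<close>

definition flat ::
  "'a topology \<Rightarrow> ('a, 'e::real_inner) chart set \<Rightarrow>
   ('a \<Rightarrow> ('a, 'e) tvec \<Rightarrow> ('a, 'e) tvec \<Rightarrow> real) \<Rightarrow>
   ('a \<Rightarrow> ('a, 'e) tvec) \<Rightarrow> 'a \<Rightarrow> ('a, 'e) cvec" where
  "flat M A g X = (\<lambda>p v. if p \<in> topspace M \<and> v \<in> tangent_space A p then g p (X p) v else 0)"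

definition sharp ::
  "'a topology \<Rightarrow> ('a, 'e::real_inner) chart set \<Rightarrow>
   ('a \<Rightarrow> ('a, 'e) tvec \<Rightarrow> ('a, 'e) tvec \<Rightarrow> real) \<Rightarrow>
   ('a \<Rightarrow> ('a, 'e) cvec) \<Rightarrow> 'a \<Rightarrow> ('a, 'e) tvec" where
  "sharp M A g \<omega> = (THE X. X \<in> vector_fields A (topspace M) \<and> flat M A g X = \<omega>)"

definition module_automorphism ::
  "'a topology \<Rightarrow> ('a, 'e::real_inner) chart set \<Rightarrow>
   (('a \<Rightarrow> ('a, 'e) tvec) \<Rightarrow> 'a \<Rightarrow> ('a, 'e) tvec) \<Rightarrow> bool" where
  "module_automorphism M A B \<longleftrightarrow>
     bij_betw B (vector_fields A (topspace M)) (vector_fields A (topspace M)) \<and>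
     (\<forall>X\<in>vector_fields A (topspace M). \<forall>Y\<in>vector_fields A (topspace M). B (X + Y) = B X + B Y) \<and>
     (\<forall>f\<in>smooth_functions A (topspace M). \<forall>X\<in>vector_fields A (topspace M).
        B (\<lambda>p. f p *\<^sub>R X p) = (\<lambda>p. f p *\<^sub>R B X p))"

definition orthogonal_automorphism ::
  "'a topology \<Rightarrow> ('a, 'e::real_inner) chart set \<Rightarrow>
   ('a \<Rightarrow> ('a, 'e) tvec \<Rightarrow> ('a, 'e) tvec \<Rightarrow> real) \<Rightarrow>
   (('a \<Rightarrow> ('a, 'e) tvec) \<Rightarrow> 'a \<Rightarrow> ('a, 'e) tvec) \<Rightarrow> bool" where
  "orthogonal_automorphism M A g B \<longleftrightarrow> module_automorphism M A B \<and>
     (\<forall>X\<in>vector_fields A (topspace M). \<forall>Y\<in>vector_fields A (topspace M). \<forall>p\<in>topspace M.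
        g p (B X p) (B Y p) = g p (X p) (Y p))"

text \<open>The induced action on 1-forms, \<open>B \<omega>\<^sub>X = \<omega>\<^bsub>BX\<^esub>\<close>.\<close>

definition form_action ::
  "'a topology \<Rightarrow> ('a, 'e::real_inner) chart set \<Rightarrow>
   ('a \<Rightarrow> ('a, 'e) tvec \<Rightarrow> ('a, 'e) tvec \<Rightarrow> real) \<Rightarrow>
   (('a \<Rightarrow> ('a, 'e) tvec) \<Rightarrow> 'a \<Rightarrow> ('a, 'e) tvec) \<Rightarrow>
   ('a \<Rightarrow> ('a, 'e) cvec) \<Rightarrow> 'a \<Rightarrow> ('a, 'e) cvec" where
  "form_action M A g B \<omega> = flat M A g (B (sharp M A g \<omega>))"

definition pairing :: "('v \<times> ('v \<Rightarrow> real)) \<Rightarrow> ('v \<times> ('v \<Rightarrow> real)) \<Rightarrow> real" where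
  "pairing a b = (1/2) * (snd b (fst a) + snd a (fst b))"

definition isotropic_at ::
  "('a, 'e::real_inner) chart set \<Rightarrow> 'a \<Rightarrow> (('a, 'e) tvec \<times> ('a, 'e) cvec) set \<Rightarrow> bool" where
  "isotropic_at A p V \<longleftrightarrow> subspace V \<and> V \<subseteq> tangent_space A p \<times> cotangent_space A p \<and>
     (\<forall>a\<in>V. \<forall>b\<in>V. pairing a b = 0)"

definition maximal_isotropic_at ::
  "('a, 'e::real_inner) chart set \<Rightarrow> 'a \<Rightarrow> (('a, 'e) tvec \<times> ('a, 'e) cvec) set \<Rightarrow> bool" where
  "maximal_isotropic_at A p V \<longleftrightarrow> isotropic_at A p V \<and>
     (\<forall>V'. isotropic_at A p V' \<and> V \<subseteq> V' \<longrightarrow> V' = V)"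

text \<open>Smooth subbundles of \<open>TM \<oplus> T\<^sup>*M\<close> of rank \<open>k\<close>, as families of fibres admitting smooth local
  frames. Only the fibres over points of the manifold matter.\<close>

definition smooth_subbundle ::
  "nat \<Rightarrow> 'a topology \<Rightarrow> ('a, 'e::real_inner) chart set \<Rightarrow>
   ('a \<Rightarrow> (('a, 'e) tvec \<times> ('a, 'e) cvec) set) \<Rightarrow> bool" where
  "smooth_subbundle k M A L \<longleftrightarrow>
     (\<forall>p\<in>topspace M. subspace (L p) \<and> L p \<subseteq> tangent_space A p \<times> cotangent_space A p) \<and>
     (\<forall>p\<in>topspace M. \<exists>W X \<omega>. openin M W \<and> p \<in> W \<and>
        (\<forall>i<k. X i \<in> vector_fields A W \<and> \<omega> i \<in> one_forms A W) \<and>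
        (\<forall>q\<in>W. inj_on (\<lambda>i. (X i q, \<omega> i q)) {..<k} \<and>
           independent ((\<lambda>i. (X i q, \<omega> i q)) ` {..<k}) \<and>
           span ((\<lambda>i. (X i q, \<omega> i q)) ` {..<k}) = L q))"

definition dirac_structure ::
  "'a topology \<Rightarrow> ('a, 'e::real_inner) chart set \<Rightarrow>
   ('a \<Rightarrow> (('a, 'e) tvec \<times> ('a, 'e) cvec) set) \<Rightarrow> bool" where
  "dirac_structure M A L \<longleftrightarrow> (\<exists>k. smooth_subbundle k M A L) \<and>
     (\<forall>p\<in>topspace M. maximal_isotropic_at A p (L p))"

definition sections_of ::
  "'a topology \<Rightarrow> ('a, 'e::real_inner) chart set \<Rightarrow>
   ('a \<Rightarrow> (('a, 'e) tvec \<times> ('a, 'e) cvec) set) \<Rightarrow>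
   (('a \<Rightarrow> ('a, 'e) tvec) \<times> ('a \<Rightarrow> ('a, 'e) cvec)) set" where
  "sections_of M A L = {(X, \<omega>).
     X \<in> vector_fields A (topspace M) \<and> \<omega> \<in> one_forms A (topspace M) \<and>
     (\<forall>p\<in>topspace M. (X p, \<omega> p) \<in> L p)}"

definition L_module ::
  "'a topology \<Rightarrow> ('a, 'e::real_inner) chart set \<Rightarrow>
   ('a \<Rightarrow> ('a, 'e) tvec \<Rightarrow> ('a, 'e) tvec \<Rightarrow> real) \<Rightarrow>
   (('a \<Rightarrow> ('a, 'e) tvec) \<Rightarrow> 'a \<Rightarrow> ('a, 'e) tvec) \<Rightarrow>
   (('a \<Rightarrow> ('a, 'e) tvec) \<times> ('a \<Rightarrow> ('a, 'e) cvec)) set" where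
  "L_module M A g B =
     {(X + B X, flat M A g X - form_action M A g B (flat M A g X)) | X.
        X \<in> vector_fields A (topspace M)}"

end

theory Submission
  imports Defs
begin

text \<open>Orthogonality gives \<open>|B X p| = |X p|\<close>, so \<open>B\<close> acts fibrewise without any appeal to
  partitions of unity, and \<open>L\<^sub>B\<close> has fibres \<open>{(v + Bv, g(v - Bv, \<cdot>))}\<close>. These are isotropic because the
  pairing of the elements given by \<open>v\<close> and \<open>w\<close> is \<open>g(v, w) - g(Bv, Bw) = 0\<close>. They are maximal: if
  \<open>(y, g(z, \<cdot>))\<close> annihilates the fibre, then \<open>g(v, y + z) = g(Bv, y - z)\<close> for all \<open>v\<close>, and since \<open>B\<close> is
  onto and orthogonal, \<open>B(y + z) = y - z\<close>, so \<open>(y, g(z, \<cdot>))\<close> is the element given by \<open>v = (y + z)/2\<close>.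
  The same formula recovers \<open>X\<close> from a section of the bundle; it is smooth because \<open>\<omega> \<mapsto> X\<^sub>\<omega>\<close>
  preserves smoothness. Local frames are the images of coordinate fields that were multiplied by a bump
  function to become global, as \<open>B\<close> is defined on global fields only.\<close>

section \<open>Smooth maps\<close>

lemma Ck_on_subset: "Ck_on k S f \<Longrightarrow> T \<subseteq> S \<Longrightarrow> Ck_on k T f"
  by (induction k arbitrary: f) (auto intro: continuous_on_subset)

text \<open>On an open set, \<open>f\<close> and \<open>g\<close> agree near each point and so have
  the same derivatives there, which carries the induction.\<close>

lemma Ck_on_cong:
  assumes "open S" "Ck_on k S f" "\<And>x. x \<in> S \<Longrightarrow> f x = g x"
  shows "Ck_on k S g"
  using assms(2,3)
proof (induction k arbitrary: f g)
  case 0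
  then show ?case by (simp cong: continuous_on_cong)
next
  case (Suc k)
  have der: "(g has_derivative frechet_derivative f (at x)) (at x)" if "x \<in> S" for x
  proof (rule has_derivative_transform_within_open[OF _ assms(1) that])
    show "(f has_derivative frechet_derivative f (at x)) (at x)"
      using Suc.prems(1) that by (simp add: frechet_derivative_works)
  qed (rule Suc.prems(2))
  have "Ck_on k S (\<lambda>x. frechet_derivative g (at x) u)" for u
  proof (rule Suc.IH)
    show "Ck_on k S (\<lambda>x. frechet_derivative f (at x) u)" using Suc.prems(1) by simp
    show "frechet_derivative f (at x) u = frechet_derivative g (at x) u" if "x \<in> S" for x
      using frechet_derivative_at[OF der[OF that]] by simp
  qed
  with der show ?case by (auto simp: differentiable_def)
qed

text \<open>By uniqueness of derivatives, an explicit formula for the derivative may replace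
  \<open>frechet_derivative\<close>. The closure properties below all use this form.\<close>

lemma Ck_on_SucI:
  assumes "open S" "\<And>x. x \<in> S \<Longrightarrow> (f has_derivative f' x) (at x)"
    and "\<And>u. Ck_on k S (\<lambda>x. f' x u)"
  shows "Ck_on (Suc k) S f"
proof -
  have "Ck_on k S (\<lambda>x. frechet_derivative f (at x) u)" for u
    by (rule Ck_on_cong[OF assms(1) assms(3)[of u]])
       (simp flip: frechet_derivative_at[OF assms(2)])
  with assms(2) show ?thesis by (auto simp: differentiable_def)
qed

lemma Ck_on_Suc_has_derivative:
  "Ck_on (Suc k) S f \<Longrightarrow> x \<in> S \<Longrightarrow> (f has_derivative frechet_derivative f (at x)) (at x)"
  by (simp add: frechet_derivative_works)

lemma Ck_on_Suc_imp: "Ck_on (Suc k) S f \<Longrightarrow> Ck_on k S f"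
proof (induction k arbitrary: f)
  case 0
  then show ?case
    by (auto intro!: continuous_at_imp_continuous_on differentiable_imp_continuous_within)
next
  case (Suc k)
  then show ?case by simp
qed

text \<open>Continuity and differentiability at a point depend only on a neighbourhood, and the same
  \<open>T\<close> serves for every directional derivative. This later glues a cut-off field from
  its formula in a chart and the zero field.\<close>

lemma Ck_on_local:
  assumes "\<And>x. x \<in> S \<Longrightarrow> \<exists>T. open T \<and> x \<in> T \<and> Ck_on k T f"
  shows "Ck_on k S f"
  using assms
proof (induction k arbitrary: f)
  case 0
  then show ?case
    by (metis Ck_on.simps(1) continuous_at_imp_continuous_on continuous_on_eq_continuous_at)
next
  case (Suc k)
  have "f differentiable (at x)" if "x \<in> S" for x
    using Suc.prems[OF that] by auto
  moreover have "Ck_on k S (\<lambda>x. frechet_derivative f (at x) u)" for u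
    by (rule Suc.IH) (metis Suc.prems Ck_on.simps(2))
  ultimately show ?case by simp
qed

lemma Ck_on_const: "Ck_on k S (\<lambda>x. a)"
  by (induction k arbitrary: a) auto

lemma Ck_on_bounded_linear:
  assumes "bounded_linear f"
  shows "Ck_on k S f"
proof (cases k)
  case 0
  then show ?thesis using assms by (simp add: linear_continuous_on)
next
  case (Suc m)
  have D: "(f has_derivative f) (at x)" for x
    using assms by (rule bounded_linear_imp_has_derivative)
  then show ?thesis
    using Suc by (auto simp: differentiable_def Ck_on_const simp flip: frechet_derivative_at[OF D])
qed

lemma Ck_on_add:
  assumes "open S" "Ck_on k S f" "Ck_on k S g"
  shows "Ck_on k S (\<lambda>x. f x + g x)"
  using assms(2,3)
proof (induction k arbitrary: f g)
  case 0
  then show ?case by (auto intro: continuous_intros)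
next
  case (Suc k)
  show ?case
    by (rule Ck_on_SucI[OF assms(1) has_derivative_add[OF
            Ck_on_Suc_has_derivative[OF Suc.prems(1)] Ck_on_Suc_has_derivative[OF Suc.prems(2)]]])
       (use Suc in auto)
qed

lemma Ck_on_sum:
  assumes "open S" "\<And>i. i \<in> I \<Longrightarrow> Ck_on k S (f i)"
  shows "Ck_on k S (\<lambda>x. \<Sum>i\<in>I. f i x)"
  using assms(2)
  by (induction I rule: infinite_finite_induct) (auto intro: Ck_on_const Ck_on_add assms(1))

text \<open>Leibniz rule: the derivative is a sum of two products to which the induction hypothesis
  applies. Products, scalings and inner products are all instances.\<close>

lemma Ck_on_bilinear:
  assumes "bounded_bilinear mul" "open S" "Ck_on k S f" "Ck_on k S g"
  shows "Ck_on k S (\<lambda>x. mul (f x) (g x))"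
  using assms(3,4)
proof (induction k arbitrary: f g)
  case 0
  then show ?case by (auto intro: bounded_bilinear.continuous_on[OF assms(1)])
next
  case (Suc k)
  have "Ck_on k S (\<lambda>x. mul (f x) (frechet_derivative g (at x) u))"
    "Ck_on k S (\<lambda>x. mul (frechet_derivative f (at x) u) (g x))" for u
    using Suc.prems Suc.prems[THEN Ck_on_Suc_imp] by (auto intro: Suc.IH)
  then show ?case
    by (intro Ck_on_SucI[OF assms(2) bounded_bilinear.FDERIV[OF assms(1)
            Ck_on_Suc_has_derivative[OF Suc.prems(1)] Ck_on_Suc_has_derivative[OF Suc.prems(2)]]]
          Ck_on_add[OF assms(2)])
qed

text \<open>The derivative of \<open>1/f\<close> is \<open>-(1/f) f' (1/f)\<close>, in which
  \<open>1/f\<close> is C^k by the induction hypothesis.\<close>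

lemma Ck_on_inverse:
  fixes f :: "'a::real_normed_vector \<Rightarrow> real"
  assumes "open S" "Ck_on k S f" "\<And>x. x \<in> S \<Longrightarrow> f x \<noteq> 0"
  shows "Ck_on k S (\<lambda>x. inverse (f x))"
  using assms(2)
proof (induction k)
  case 0
  then show ?case using assms(3) by (auto intro!: continuous_intros)
next
  case (Suc k)
  have inv: "Ck_on k S (\<lambda>x. inverse (f x))" using Suc Ck_on_Suc_imp by blast
  show ?case
  proof (rule Ck_on_SucI[OF assms(1) Deriv.has_derivative_inverse[OF assms(3)
            Ck_on_Suc_has_derivative[OF Suc.prems]]])
    fix u
    have "Ck_on k S (\<lambda>x. inverse (f x) * frechet_derivative f (at x) u * inverse (f x))"
      using Suc.prems inv
      by (auto intro!: Ck_on_bilinear[OF bounded_bilinear_mult] assms(1))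
    from Ck_on_bilinear[OF bounded_bilinear_mult assms(1) Ck_on_const[of _ _ "-1"] this]
    show "Ck_on k S (\<lambda>x. - (inverse (f x) * frechet_derivative f (at x) u * inverse (f x)))"
      by simp
  qed auto
qed

text \<open>The chain rule differentiates \<open>f\<close> in the direction \<open>Dg x u\<close>,
  which varies with \<open>x\<close>, whereas \<open>Ck_on\<close> controls fixed directions only.
  Expanding that direction in the finite basis \<open>b\<close> leaves a sum of products of C^k
  functions.\<close>

lemma Ck_on_compose:
  fixes g :: "'c::real_normed_vector \<Rightarrow> 'e::real_inner" and f :: "'e \<Rightarrow> 'f::real_normed_vector"
    and b :: "'e set"
  assumes b: "finite b" "\<And>x. (\<Sum>i\<in>b. (x \<bullet> i) *\<^sub>R i) = x"
    and "open S" "Ck_on k S g" "Ck_on k T f" "g ` S \<subseteq> T"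
  shows "Ck_on k S (\<lambda>x. f (g x))"
  using assms(4,5)
proof (induction k arbitrary: f)
  case 0
  then show ?case using assms(6) by (auto intro: continuous_on_compose2)
next
  case (Suc k)
  let ?Df = "\<lambda>x. frechet_derivative f (at (g x))" and ?Dg = "\<lambda>x. frechet_derivative g (at x)"
  have gT: "g x \<in> T" if "x \<in> S" for x using that assms(6) by auto
  have Df: "(f has_derivative ?Df x) (at (g x))" if "x \<in> S" for x
    using Ck_on_Suc_has_derivative[OF Suc.prems(2) gT[OF that]] .
  have "?Df x v = (\<Sum>i\<in>b. (v \<bullet> i) *\<^sub>R ?Df x i)" if "x \<in> S" for x v
  proof -
    have lin: "linear (?Df x)" using Df[OF that] by (rule has_derivative_linear)
    have "?Df x v = ?Df x (\<Sum>i\<in>b. (v \<bullet> i) *\<^sub>R i)" by (simp add: b)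
    then show ?thesis by (simp add: linear_sum[OF lin] linear_cmul[OF lin])
  qed
  then have D: "((\<lambda>x. f (g x)) has_derivative (\<lambda>u. \<Sum>i\<in>b. (?Dg x u \<bullet> i) *\<^sub>R ?Df x i)) (at x)"
    if "x \<in> S" for x
    using has_derivative_compose[OF Ck_on_Suc_has_derivative[OF Suc.prems(1) that] Df[OF that]] that
    by simp
  show ?case
  proof (rule Ck_on_SucI[OF assms(3) D])
    fix u
    have "Ck_on k S (\<lambda>x. ?Df x i)" for i
      using Suc.prems Suc.prems(1)[THEN Ck_on_Suc_imp]
      by (intro Suc.IH[of "\<lambda>y. frechet_derivative f (at y) i"]) auto
    moreover have "Ck_on k S (\<lambda>x. ?Dg x u)" using Suc.prems by simp
    ultimately show "Ck_on k S (\<lambda>x. \<Sum>i\<in>b. (?Dg x u \<bullet> i) *\<^sub>R ?Df x i)"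
      by (intro Ck_on_sum Ck_on_bilinear[OF bounded_bilinear_scaleR]
            Ck_on_bilinear[OF bounded_bilinear_inner] assms(3) Ck_on_const)
  qed
qed

section \<open>Smooth maps\<close>

lemma smooth_on_subset: "smooth_on S f \<Longrightarrow> T \<subseteq> S \<Longrightarrow> smooth_on T f"
  by (auto simp: smooth_on_def intro: Ck_on_subset)

lemma smooth_on_cong:
  "open S \<Longrightarrow> smooth_on S f \<Longrightarrow> (\<And>x. x \<in> S \<Longrightarrow> f x = g x) \<Longrightarrow> smooth_on S g"
  unfolding smooth_on_def using Ck_on_cong[of S _ f g] by simp

lemma smooth_on_local:
  "(\<And>x. x \<in> S \<Longrightarrow> \<exists>T. open T \<and> x \<in> T \<and> smooth_on T f) \<Longrightarrow> smooth_on S f"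
  unfolding smooth_on_def by (intro allI Ck_on_local) metis

lemma smooth_on_const: "smooth_on S (\<lambda>x. a)"
  by (simp add: smooth_on_def Ck_on_const)

lemma smooth_on_bounded_linear: "bounded_linear f \<Longrightarrow> smooth_on S f"
  by (simp add: smooth_on_def Ck_on_bounded_linear)

lemma smooth_on_id: "smooth_on S (\<lambda>x. x)"
  by (simp add: smooth_on_bounded_linear)

lemma smooth_on_add: "open S \<Longrightarrow> smooth_on S f \<Longrightarrow> smooth_on S h \<Longrightarrow> smooth_on S (\<lambda>x. f x + h x)"
  by (simp add: smooth_on_def Ck_on_add)

lemma smooth_on_sum:
  "open S \<Longrightarrow> (\<And>i. i \<in> I \<Longrightarrow> smooth_on S (F i)) \<Longrightarrow> smooth_on S (\<lambda>x. \<Sum>i\<in>I. F i x)"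
  by (simp add: smooth_on_def Ck_on_sum)

lemma smooth_on_frechet_derivative:
  assumes "smooth_on S f"
  shows "smooth_on S (\<lambda>x. frechet_derivative f (at x) u)"
  unfolding smooth_on_def
proof
  fix k
  show "Ck_on k S (\<lambda>x. frechet_derivative f (at x) u)"
    using assms[unfolded smooth_on_def, rule_format, of "Suc k"] by simp
qed

lemma smooth_on_has_derivative:
  "smooth_on S f \<Longrightarrow> x \<in> S \<Longrightarrow> (f has_derivative frechet_derivative f (at x)) (at x)"
  unfolding smooth_on_def using Ck_on_Suc_has_derivative by metis

lemma smooth_on_bilinear:
  "bounded_bilinear mul \<Longrightarrow> open S \<Longrightarrow> smooth_on S f \<Longrightarrow> smooth_on S g \<Longrightarrow>
    smooth_on S (\<lambda>x. mul (f x) (g x))"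
  unfolding smooth_on_def by (blast intro: Ck_on_bilinear)

lemma smooth_on_divide:
  fixes f g :: "'a::real_normed_vector \<Rightarrow> real"
  assumes "open S" "smooth_on S f" "smooth_on S g" "\<And>x. x \<in> S \<Longrightarrow> g x \<noteq> 0"
  shows "smooth_on S (\<lambda>x. f x / g x)"
  unfolding divide_inverse
  using assms(2,3) Ck_on_inverse[OF assms(1) _ assms(4)]
  by (intro smooth_on_bilinear[OF bounded_bilinear_mult] assms(1,2)) (simp_all add: smooth_on_def)

lemma smooth_on_diff:
  assumes "open S" "smooth_on S f" "smooth_on S g"
  shows "smooth_on S (\<lambda>x. f x - g x)"
  using smooth_on_add[OF assms(1,2)
      smooth_on_bilinear[OF bounded_bilinear_scaleR assms(1) smooth_on_const[of _ "-1"] assms(3)]]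
  by simp

lemma smooth_on_compose:
  fixes g :: "'c::real_normed_vector \<Rightarrow> 'e::real_inner" and f :: "'e \<Rightarrow> 'f::real_normed_vector"
    and b :: "'e set"
  assumes "finite b" "\<And>x. (\<Sum>i\<in>b. (x \<bullet> i) *\<^sub>R i) = x"
    and "open S" "smooth_on S g" "smooth_on T f" "g ` S \<subseteq> T"
  shows "smooth_on S (\<lambda>x. f (g x))"
  using assms by (auto simp: smooth_on_def intro: Ck_on_compose)

section \<open>Bump functions\<close>

definition flat_exp :: "nat \<Rightarrow> real \<Rightarrow> real" where
  "flat_exp m t = (if t > 0 then exp (- (1 / t)) / t ^ m else 0)"

text \<open>From the right, \<open>s = 1/t\<close> turns the claim into \<open>s^m / exp s\<close>
  tending to 0 at infinity; on the left the function is zero.\<close>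

lemma flat_exp_tendsto_0: "(flat_exp m \<longlongrightarrow> 0) (at 0)"
proof -
  have "((\<lambda>t::real. inverse t ^ m / exp (inverse t)) \<longlongrightarrow> 0) (at_right 0)"
    by (rule filterlim_compose[OF tendsto_power_div_exp_0 filterlim_inverse_at_top_right])
  then have "(flat_exp m \<longlongrightarrow> 0) (at_right 0)"
    by (rule Lim_transform_eventually)
       (auto simp: eventually_at_filter flat_exp_def exp_minus field_simps)
  moreover have "(flat_exp m \<longlongrightarrow> 0) (at_left 0)"
    by (rule tendsto_eventually) (auto simp: eventually_at_filter flat_exp_def)
  ultimately show ?thesis by (simp add: filterlim_at_split)
qed

text \<open>Differentiation stays within the linear span of the family, which is why the powers
  \<open>t^m\<close> are carried along: smoothness of all members then follows by one
  induction.\<close>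

lemma flat_exp_has_field_derivative:
  "(flat_exp m has_field_derivative flat_exp (m + 2) t - real m * flat_exp (m + 1) t) (at t)"
proof (cases t "0::real" rule: linorder_cases)
  case less
  have "((\<lambda>_. 0) has_field_derivative 0) (at t)" by simp
  from has_field_derivative_transform_within_open[OF this, of "{..<0}" "flat_exp m"] less
  show ?thesis by (auto simp: flat_exp_def)
next
  case equal
  \<comment> \<open>The difference quotient of \<open>flat_exp m\<close> at 0 is
    \<open>flat_exp (Suc m)\<close>.\<close>
  have "(flat_exp m has_field_derivative 0) (at 0)"
    unfolding has_field_derivative_iff
    using flat_exp_tendsto_0[of "Suc m"]
    by (rule Lim_transform_eventually)
       (auto simp: eventually_at_filter flat_exp_def field_simps)
  then show ?thesis using equal by (simp add: flat_exp_def)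
next
  case greater
  have e: "((\<lambda>t. exp (- (1 / t))) has_field_derivative exp (- (1 / t)) / t\<^sup>2) (at t)"
    using greater by (auto intro!: derivative_eq_intros simp: power2_eq_square)
  have "((\<lambda>t. exp (- (1 / t)) / t ^ m) has_field_derivative
      flat_exp (m + 2) t - real m * flat_exp (m + 1) t) (at t)"
    by (rule DERIV_cong[OF DERIV_divide[OF e DERIV_pow[of m]]])
       (use greater in \<open>cases m; simp add: flat_exp_def field_simps power2_eq_square\<close>)+
  from has_field_derivative_transform_within_open[OF this, of "{0<..}" "flat_exp m"] greater
  show ?thesis by (auto simp: flat_exp_def)
qed

lemma smooth_on_flat_exp: "smooth_on UNIV (flat_exp m)"
proof -
  have "Ck_on k UNIV (flat_exp m)" for k
  proof (induction k arbitrary: m)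
    case 0
    show ?case
      using flat_exp_has_field_derivative
      by (auto intro!: continuous_at_imp_continuous_on DERIV_isCont)
  next
    case (Suc k)
    have *: "Ck_on k UNIV (\<lambda>t. c * flat_exp j t)" for c j
      by (intro Ck_on_bilinear[OF bounded_bilinear_mult] Ck_on_const Suc) auto
    have "Ck_on k UNIV (\<lambda>t. u * flat_exp (m + 2) t + (- u * real m) * flat_exp (m + 1) t)" for u
      by (intro Ck_on_add *) auto
    then have "Ck_on k UNIV (\<lambda>t. (flat_exp (m + 2) t - real m * flat_exp (m + 1) t) * u)" for u
      by (simp add: algebra_simps)
    then show ?case
      using flat_exp_has_field_derivative
      by (intro Ck_on_SucI[of _ _ "\<lambda>t. (*) (flat_exp (m + 2) t - real m * flat_exp (m + 1) t)"])
         (auto simp: has_field_derivative_def)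
  qed
  then show ?thesis by (simp add: smooth_on_def)
qed

text \<open>The function \<open>exp(-1/t)\<close>, extended by 0, is applied to
  \<open>r^2 - |x - x0|^2\<close>, which is smooth and positive exactly on the ball.\<close>

lemma smooth_bump:
  fixes x0 :: "'e::real_inner"
  assumes "r > 0"
  obtains \<psi> :: "'e \<Rightarrow> real"
  where "smooth_on UNIV \<psi>" "\<And>x. \<psi> x \<noteq> 0 \<longleftrightarrow> x \<in> ball x0 r"
proof
  let ?q = "\<lambda>x. r\<^sup>2 - (x - x0) \<bullet> (x - x0)"
  have "smooth_on UNIV ?q"
    by (intro smooth_on_diff smooth_on_bilinear[OF bounded_bilinear_inner]
        smooth_on_id smooth_on_const) auto
  then show "smooth_on UNIV (\<lambda>x. flat_exp 0 (?q x))"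
    \<comment> \<open>The intermediate space of the composition is the real line, with basis
      \<open>{1}\<close>.\<close>
    by (intro smooth_on_compose[of "{1}" UNIV ?q UNIV "flat_exp 0"] smooth_on_flat_exp) auto
  have "norm y < r \<longleftrightarrow> y \<bullet> y < r\<^sup>2" for y :: 'e
    using assms by (simp add: norm_lt_square)
  from this[of "x - x0" for x] show "flat_exp 0 (?q x) \<noteq> 0 \<longleftrightarrow> x \<in> ball x0 r" for x
    by (simp add: flat_exp_def dist_norm norm_minus_commute[of x0])
qed

section \<open>Smooth frames and Riesz representation\<close>

text \<open>The box of combinations with coefficients in \<open>[-r, r]\<close> is compact, being a
  finite sum of segments, and by Cauchy-Schwarz it contains the ball about 0 as a closed
  subset.\<close>

lemma compact_cball_of_basis:
  fixes b :: "'e::real_inner set"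
  assumes "finite b" "\<And>i. i \<in> b \<Longrightarrow> norm i = 1" "\<And>x. (\<Sum>i\<in>b. (x \<bullet> i) *\<^sub>R i) = x"
  shows "compact (cball (a::'e) r)"
proof -
  let ?box = "\<lambda>b. {\<Sum>i\<in>b. c i *\<^sub>R i | c. \<forall>i\<in>b. \<bar>c i\<bar> \<le> r}"
  have "compact (?box c)" if "finite c" for c :: "'e set"
    using that
  proof (induction c)
    case empty
    then show ?case by simp
  next
    case (insert j c)
    have "compact ((\<lambda>t. t *\<^sub>R j) ` {-r..r})"
      by (intro compact_continuous_image continuous_intros compact_Icc)
    from compact_sums[OF this insert.IH]
    have "compact {x + y | x y. x \<in> (\<lambda>t. t *\<^sub>R j) ` {-r..r} \<and> y \<in> ?box c}" .
    moreover have "{x + y | x y. x \<in> (\<lambda>t. t *\<^sub>R j) ` {-r..r} \<and> y \<in> ?box c} = ?box (insert j c)"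
    proof (intro equalityI subsetI)
      fix z assume "z \<in> {x + y | x y. x \<in> (\<lambda>t. t *\<^sub>R j) ` {-r..r} \<and> y \<in> ?box c}"
      then obtain t d where t: "\<bar>t\<bar> \<le> r" "\<forall>i\<in>c. \<bar>d i\<bar> \<le> r" "z = t *\<^sub>R j + (\<Sum>i\<in>c. d i *\<^sub>R i)"
        by auto (metis abs_le_iff minus_le_iff)
      have "(\<Sum>i\<in>c. (d(j := t)) i *\<^sub>R i) = (\<Sum>i\<in>c. d i *\<^sub>R i)"
        using insert.hyps by (intro sum.cong) auto
      with t insert.hyps have "z = (\<Sum>i\<in>insert j c. (d(j := t)) i *\<^sub>R i)" by simp
      moreover have "\<forall>i\<in>insert j c. \<bar>(d(j := t)) i\<bar> \<le> r" using t by simp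
      ultimately show "z \<in> ?box (insert j c)" by blast
    next
      fix z assume "z \<in> ?box (insert j c)"
      then obtain d where "\<forall>i\<in>insert j c. \<bar>d i\<bar> \<le> r" "z = (\<Sum>i\<in>insert j c. d i *\<^sub>R i)"
        by blast
      then have "z = d j *\<^sub>R j + (\<Sum>i\<in>c. d i *\<^sub>R i)" "d j \<in> {-r..r}" "\<forall>i\<in>c. \<bar>d i\<bar> \<le> r"
        using insert.hyps by (auto simp: abs_le_iff)
      then show "z \<in> {x + y | x y. x \<in> (\<lambda>t. t *\<^sub>R j) ` {-r..r} \<and> y \<in> ?box c}"
        by blast
    qed
    ultimately show ?case by simp
  qed
  then have "compact (?box b)" using assms(1) .
  moreover have "cball 0 r \<subseteq> ?box b"
  proof
    fix x :: 'e assume "x \<in> cball 0 r"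
    then have "\<bar>x \<bullet> i\<bar> \<le> r" if "i \<in> b" for i
      using Cauchy_Schwarz_ineq2[of x i] assms(2)[OF that] by simp
    then show "x \<in> ?box b"
      using assms(3)[of x] by (intro CollectI exI[of _ "\<lambda>i. x \<bullet> i"]) auto
  qed
  ultimately have "compact (cball (0::'e) r)"
    using compact_Int_closed[of "?box b" "cball 0 r"] by (simp add: Int_absorb1)
  from compact_translation[OF this, of a] show ?thesis
    by (simp add: image_add_cball)
qed

text \<open>A finite spanning set is orthogonalised, the zero vector is dropped and the rest is
  normalised. In dimension 0 the result is the empty set.\<close>

lemma orthonormal_basis_exists:
  fixes c :: "'e::real_inner set"
  assumes "finite c" "span c = UNIV"
  obtains b :: "'e set"
  where "finite b" "\<And>i. i \<in> b \<Longrightarrow> norm i = 1" "\<And>x. (\<Sum>i\<in>b. (x \<bullet> i) *\<^sub>R i) = x" "independent b"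
proof -
  obtain d :: "'e set" where d: "finite d" "span d = UNIV" "pairwise orthogonal d"
    using basis_orthogonal[OF assms(1)] assms(2) by auto
  define b where "b = (\<lambda>x. x /\<^sub>R norm x) ` (d - {0})"
  have fin: "finite b" using d by (simp add: b_def)
  have norm1: "norm i = 1" if "i \<in> b" for i using that by (auto simp: b_def field_simps split: if_splits)
  have "x \<in> span b" if "x \<in> d" for x
  proof (cases "x = 0")
    case False
    then have "norm x *\<^sub>R (x /\<^sub>R norm x) \<in> span b" using that by (intro span_scale span_base) (auto simp: b_def)
    then show ?thesis using False by simp
  qed (simp add: span_zero)
  then have sp: "span b = UNIV"
    using d(2) span_mono[of d "span b"] by (auto simp: span_span)
  have orth: "pairwise orthogonal b"
    using d(3) by (auto simp: b_def pairwise_def orthogonal_def)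
  have ind: "independent b"
  proof (rule pairwise_orthogonal_independent[OF orth])
    show "0 \<notin> b" using norm1[of 0] by auto
  qed
  have "(\<Sum>i\<in>b. (x \<bullet> i) *\<^sub>R i) = x" for x
  proof -
    obtain u where x: "x = (\<Sum>i\<in>b. u i *\<^sub>R i)"
      using sp span_finite[OF fin] by blast
    have "x \<bullet> j = u j" if "j \<in> b" for j
    proof -
      have "x \<bullet> j = (\<Sum>i\<in>b. u i * (i \<bullet> j))" unfolding x by (simp add: inner_sum_left)
      also have "\<dots> = (\<Sum>i\<in>b. if i = j then u i else 0)"
      proof (intro sum.cong refl)
        fix i assume "i \<in> b"
        then show "u i * (i \<bullet> j) = (if i = j then u i else 0)"
          using pairwiseD[OF orth \<open>i \<in> b\<close> that] norm1[OF that]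
          by (simp add: orthogonal_def dot_square_norm)
      qed
      also have "\<dots> = u j" using fin that by simp
      finally show ?thesis .
    qed
    then show ?thesis using x by simp
  qed
  with fin norm1 ind that show ?thesis by blast
qed

section \<open>Smooth families of inner products\<close>

lemma smooth_on_bilinear_form:
  fixes G :: "'x::real_normed_vector \<Rightarrow> 'e::real_inner \<Rightarrow> 'e \<Rightarrow> real" and b :: "'e set"
  assumes b: "finite b" "\<And>x. (\<Sum>i\<in>b. (x \<bullet> i) *\<^sub>R i) = x"
    and S: "open S" and bil: "\<And>x. x \<in> S \<Longrightarrow> bilinear (G x)"
    and G: "\<And>u v. smooth_on S (\<lambda>x. G x u v)" and U: "smooth_on S U" and V: "smooth_on S V"
  shows "smooth_on S (\<lambda>x. G x (U x) (V x))"
proof -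
  have *: "smooth_on S (\<lambda>x. \<Sum>i\<in>b. \<Sum>j\<in>b. (U x \<bullet> i) * ((V x \<bullet> j) * G x i j))"
    by (intro smooth_on_sum smooth_on_bilinear[OF bounded_bilinear_mult]
        smooth_on_bilinear[OF bounded_bilinear_inner] S U V G smooth_on_const)
  have "G x u v = (\<Sum>i\<in>b. \<Sum>j\<in>b. (u \<bullet> i) * ((v \<bullet> j) * G x i j))" if "x \<in> S" for x u v
  proof -
    have "G x u v = G x (\<Sum>i\<in>b. (u \<bullet> i) *\<^sub>R i) (\<Sum>j\<in>b. (v \<bullet> j) *\<^sub>R j)" by (simp add: b)
    also have "\<dots> = (\<Sum>i\<in>b. \<Sum>j\<in>b. G x ((u \<bullet> i) *\<^sub>R i) ((v \<bullet> j) *\<^sub>R j))"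
      by (simp add: bilinear_sum[OF bil[OF that]] sum.cartesian_product)
    finally show ?thesis
      by (simp add: bilinear_lmul[OF bil[OF that]] bilinear_rmul[OF bil[OF that]] ac_simps)
  qed
  then show ?thesis by (intro smooth_on_cong[OF S *]) simp
qed

text \<open>Gram--Schmidt without normalisation, so that no square roots enter.\<close>

lemma smooth_orthogonal_frame_exists:
  fixes G :: "'x::real_normed_vector \<Rightarrow> 'e::real_inner \<Rightarrow> 'e \<Rightarrow> real" and b :: "'e set"
  assumes b: "finite b" "\<And>x. (\<Sum>i\<in>b. (x \<bullet> i) *\<^sub>R i) = x"
    and S: "open S"
    and bil: "\<And>x. x \<in> S \<Longrightarrow> bilinear (G x)" and sym: "\<And>x u v. x \<in> S \<Longrightarrow> G x u v = G x v u"
    and pos: "\<And>x u. x \<in> S \<Longrightarrow> u \<noteq> 0 \<Longrightarrow> G x u u > 0"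
    and G: "\<And>u v. smooth_on S (\<lambda>x. G x u v)"
    and F: "finite F" "independent F"
  shows "\<exists>E. \<forall>a\<in>F. smooth_on S (E a) \<and> (\<forall>x\<in>S. E a x \<noteq> 0 \<and> E a x \<in> span F \<and>
    a \<in> span ((\<lambda>i. E i x) ` F) \<and> (\<forall>i\<in>F. i \<noteq> a \<longrightarrow> G x (E a x) (E i x) = 0))"
  using F
proof (induction F)
  case empty
  then show ?case by simp
next
  case (insert a F)
  have "independent F" using independent_mono[OF insert.prems] by blast
  then obtain E where E0: "\<forall>a\<in>F. smooth_on S (E a) \<and> (\<forall>x\<in>S. E a x \<noteq> 0 \<and> E a x \<in> span F \<and>
    a \<in> span ((\<lambda>i. E i x) ` F) \<and> (\<forall>i\<in>F. i \<noteq> a \<longrightarrow> G x (E a x) (E i x) = 0))"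
    using insert.IH by blast
  have E: "\<And>i. i \<in> F \<Longrightarrow> smooth_on S (E i)"
    "\<And>i x. i \<in> F \<Longrightarrow> x \<in> S \<Longrightarrow> E i x \<noteq> 0"
    "\<And>i x. i \<in> F \<Longrightarrow> x \<in> S \<Longrightarrow> E i x \<in> span F"
    "\<And>i x. i \<in> F \<Longrightarrow> x \<in> S \<Longrightarrow> i \<in> span ((\<lambda>i. E i x) ` F)"
    "\<And>i j x. i \<in> F \<Longrightarrow> j \<in> F \<Longrightarrow> x \<in> S \<Longrightarrow> j \<noteq> i \<Longrightarrow> G x (E i x) (E j x) = 0"
    using E0 by blast+
  \<comment> \<open>\<open>P x\<close> is the \<open>G x\<close>-orthogonal projection of
    \<open>a\<close> to the span of the frame built so far; \<open>G x\<close> is positive definite,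
    so the denominators do not vanish.\<close>
  define P where "P x = (\<Sum>i\<in>F. (G x a (E i x) / G x (E i x) (E i x)) *\<^sub>R E i x)" for x
  define E' where "E' = E(a := \<lambda>x. a - P x)"
  have E'_a: "E' a x = a - P x" for x by (simp add: E'_def)
  have E'_F: "E' i = E i" if "i \<in> F" for i using that insert.hyps by (auto simp: E'_def)
  have "smooth_on S P"
    unfolding P_def using pos E(2)
    by (intro smooth_on_sum smooth_on_bilinear[OF bounded_bilinear_scaleR] smooth_on_divide S E(1)
        smooth_on_bilinear_form[OF b S bil G] smooth_on_const) (auto simp: less_le)
  then have smooth_a: "smooth_on S (E' a)"
    unfolding E'_def by (simp add: smooth_on_diff[OF S smooth_on_const])
  have P_span: "P x \<in> span F" if "x \<in> S" for x
    unfolding P_def by (intro span_sum span_scale E(3) that)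
  have P_span': "P x \<in> span ((\<lambda>i. E' i x) ` F)" for x
    unfolding P_def by (intro span_sum span_scale span_base) (auto simp: E'_F)
  \<comment> \<open>Subtracting \<open>P x\<close> cannot produce 0, because the old frame stays
    within \<open>span F\<close> and \<open>a\<close> lies outside it. The induction carries the
    inclusion in \<open>span F\<close> for this purpose.\<close>
  have "a \<notin> span F" using insert by (simp add: independent_insert)
  then have nz_a: "E' a x \<noteq> 0" if "x \<in> S" for x using P_span[OF that] by (auto simp: E'_a)
  have orth: "G x (E' a x) (E j x) = 0" if "j \<in> F" "x \<in> S" for j x
  proof -
    have lin: "linear (\<lambda>u. G x u (E j x))" using bil[OF that(2)] by (simp add: bilinear_def)
    have "G x (P x) (E j x) = (\<Sum>i\<in>F. (G x a (E i x) / G x (E i x) (E i x)) * G x (E i x) (E j x))"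
      unfolding P_def by (simp add: linear_sum[OF lin] linear_cmul[OF lin])
    also have "\<dots> = (\<Sum>i\<in>F. if i = j then G x a (E j x) else 0)"
      using E(2,5) that pos[OF that(2)] by (intro sum.cong refl) (auto simp: less_le)
    also have "\<dots> = G x a (E j x)" using that insert.hyps by simp
    finally show ?thesis by (simp add: E'_a linear_diff[OF lin])
  qed
  have span1: "E' i x \<in> span (insert a F)" if "i \<in> insert a F" "x \<in> S" for i x
  proof -
    have "span F \<subseteq> span (insert a F)" by (rule span_mono) auto
    moreover have "a \<in> span (insert a F)" by (simp add: span_base)
    ultimately show ?thesis
      using that E(3)[of i x] P_span[of x] span_diff[of a "insert a F" "P x"]
      by (cases "i = a") (auto simp: E'_a E'_F)
  qed
  have span2: "i \<in> span ((\<lambda>i. E' i x) ` insert a F)" if "i \<in> insert a F" "x \<in> S" for i x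
  proof (cases "i = a")
    case True
    have "E' a x + P x \<in> span ((\<lambda>i. E' i x) ` insert a F)"
    proof (rule span_add)
      show "E' a x \<in> span ((\<lambda>i. E' i x) ` insert a F)" by (rule span_base) simp
      show "P x \<in> span ((\<lambda>i. E' i x) ` insert a F)"
        by (rule subsetD[OF span_mono P_span']) auto
    qed
    then show ?thesis using True by (simp add: E'_a)
  next
    case False
    then have "i \<in> span ((\<lambda>i. E i x) ` F)" using E(4) that by auto
    also have "(\<lambda>i. E i x) ` F = (\<lambda>i. E' i x) ` F" by (auto simp: E'_F)
    finally show ?thesis using span_mono[of "(\<lambda>i. E' i x) ` F" "(\<lambda>i. E' i x) ` insert a F"] by auto
  qed
  have "G x (E' i x) (E' j x) = 0" if "i \<in> insert a F" "j \<in> insert a F" "j \<noteq> i" "x \<in> S" for i j x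
    using that orth E(5) sym[OF that(4)] by (auto simp: E'_F)
  with smooth_a nz_a span1 span2 E(1,2) show ?case
    by (intro exI[of _ E']) (auto simp: E'_F)
qed

text \<open>In a \<open>G x\<close>-orthogonal frame the representing vector has the coefficients
  \<open>\<alpha>(E i) / G(E i, E i)\<close>, which are smooth because the frame is.\<close>

lemma smooth_riesz_representation:
  fixes G :: "'x::real_normed_vector \<Rightarrow> 'e::real_inner \<Rightarrow> 'e \<Rightarrow> real" and b :: "'e set"
  assumes b: "finite b" "\<And>x. (\<Sum>i\<in>b. (x \<bullet> i) *\<^sub>R i) = x" "independent b"
    and S: "open S"
    and bil: "\<And>x. x \<in> S \<Longrightarrow> bilinear (G x)" and sym: "\<And>x u v. x \<in> S \<Longrightarrow> G x u v = G x v u"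
    and pos: "\<And>x u. x \<in> S \<Longrightarrow> u \<noteq> 0 \<Longrightarrow> G x u u > 0"
    and G: "\<And>u v. smooth_on S (\<lambda>x. G x u v)"
    and lin: "\<And>x. x \<in> S \<Longrightarrow> linear (\<alpha> x)" and \<alpha>: "\<And>u. smooth_on S (\<lambda>x. \<alpha> x u)"
  shows "\<exists>Z. smooth_on S Z \<and> (\<forall>x\<in>S. \<forall>u. G x (Z x) u = \<alpha> x u)"
proof -
  obtain E where E0: "\<forall>a\<in>b. smooth_on S (E a) \<and> (\<forall>x\<in>S. E a x \<noteq> 0 \<and> E a x \<in> span b \<and>
    a \<in> span ((\<lambda>i. E i x) ` b) \<and> (\<forall>i\<in>b. i \<noteq> a \<longrightarrow> G x (E a x) (E i x) = 0))"
    using smooth_orthogonal_frame_exists[OF b(1,2) S bil sym pos G b(1,3)] by blast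
  have E: "\<And>i. i \<in> b \<Longrightarrow> smooth_on S (E i)"
    "\<And>i x. i \<in> b \<Longrightarrow> x \<in> S \<Longrightarrow> E i x \<noteq> 0"
    "\<And>i x. i \<in> b \<Longrightarrow> x \<in> S \<Longrightarrow> i \<in> span ((\<lambda>i. E i x) ` b)"
    "\<And>i j x. i \<in> b \<Longrightarrow> j \<in> b \<Longrightarrow> x \<in> S \<Longrightarrow> j \<noteq> i \<Longrightarrow> G x (E i x) (E j x) = 0"
    using E0 by blast+
  define Z where "Z x = (\<Sum>i\<in>b. (\<alpha> x (E i x) / G x (E i x) (E i x)) *\<^sub>R E i x)" for x
  have "smooth_on S (\<lambda>x. \<alpha> x (E i x))" if "i \<in> b" for i
  proof (rule smooth_on_cong[OF S])
    show "smooth_on S (\<lambda>x. \<Sum>j\<in>b. (E i x \<bullet> j) * \<alpha> x j)"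
      by (intro smooth_on_sum smooth_on_bilinear[OF bounded_bilinear_mult]
        smooth_on_bilinear[OF bounded_bilinear_inner] S E(1) that \<alpha> smooth_on_const)
    fix x assume "x \<in> S"
    have "\<alpha> x (E i x) = \<alpha> x (\<Sum>j\<in>b. (E i x \<bullet> j) *\<^sub>R j)" by (simp add: b)
    then show "(\<Sum>j\<in>b. (E i x \<bullet> j) * \<alpha> x j) = \<alpha> x (E i x)"
      by (simp add: linear_sum[OF lin[OF \<open>x \<in> S\<close>]] linear_cmul[OF lin[OF \<open>x \<in> S\<close>]])
  qed
  then have smooth: "smooth_on S Z"
    unfolding Z_def using pos E(2)
    by (intro smooth_on_sum smooth_on_bilinear[OF bounded_bilinear_scaleR] smooth_on_divide S E(1)
        smooth_on_bilinear_form[OF b(1,2) S bil G]) (auto simp: less_le)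
  have "G x (Z x) u = \<alpha> x u" if x: "x \<in> S" for x u
  proof -
    have frame: "G x (Z x) (E j x) = \<alpha> x (E j x)" if "j \<in> b" for j
    proof -
      have l: "linear (\<lambda>u. G x u (E j x))" using bil[OF x] by (simp add: bilinear_def)
      have "G x (Z x) (E j x) = (\<Sum>i\<in>b. (\<alpha> x (E i x) / G x (E i x) (E i x)) * G x (E i x) (E j x))"
        unfolding Z_def by (simp add: linear_sum[OF l] linear_cmul[OF l])
      also have "\<dots> = (\<Sum>i\<in>b. if i = j then \<alpha> x (E j x) else 0)"
        using E(2,4) that x pos[OF x] by (intro sum.cong refl) (auto simp: less_le)
      finally show ?thesis using that b(1) by simp
    qed
    \<comment> \<open>Both sides are linear in \<open>u\<close> and agree on the frame, so it
      remains that the frame spans the model space.\<close>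
    have "b \<subseteq> span ((\<lambda>i. E i x) ` b)" using E(3) x by auto
    then have "span b \<subseteq> span ((\<lambda>i. E i x) ` b)" by (metis span_mono span_span)
    moreover have "u \<in> span b"
      using span_sum[of b "\<lambda>i. (u \<bullet> i) *\<^sub>R i" b] by (simp add: b span_scale span_base)
    ultimately have "u \<in> span ((\<lambda>i. E i x) ` b)" by auto
    moreover have "linear (G x (Z x))" using bil[OF x] by (simp add: bilinear_def)
    moreover have "G x (Z x) e = \<alpha> x e" if "e \<in> (\<lambda>i. E i x) ` b" for e
      using that frame by blast
    ultimately show ?thesis
      using linear_eq_on_span[of "G x (Z x)" "\<alpha> x"] lin[OF x] by blast
  qed
  with smooth show ?thesis by blast
qed

section \<open>Charts and vector fields\<close>

lemma scaleR_fun_apply [simp]: "(r *\<^sub>R f) x = r *\<^sub>R f x"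
  by (simp add: scaleR_fun_def)

text \<open>A single orthonormal basis \<open>b\<close> of the model space is fixed for all
  coordinate expansions; its cardinality becomes the rank of the Dirac structure.\<close>

locale smooth_atlas =
  fixes n :: nat and M :: "'a topology" and A :: "('a, 'e::real_inner) chart set" and b :: "'e set"
  assumes manifold: "smooth_manifold n M A"
    and finite_b: "finite b" and norm_b: "\<And>i. i \<in> b \<Longrightarrow> norm i = 1"
    and expand_b: "\<And>x. (\<Sum>i\<in>b. (x \<bullet> i) *\<^sub>R i) = x" and independent_b: "independent b"
begin

section \<open>Topology of charts\<close>

lemma Hausdorff: "Hausdorff_space M"
  and cover: "(\<Union>c\<in>A. fst c) = topspace M"
  and chart_homeomorphic:
    "c \<in> A \<Longrightarrow> homeomorphic_map (subtopology M (fst c)) (top_of_set (snd c ` fst c)) (snd c)"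
  and openin_chart: "c \<in> A \<Longrightarrow> openin M (fst c)"
  and open_chart_image: "c \<in> A \<Longrightarrow> open (snd c ` fst c)"
  and smooth_transition:
    "c \<in> A \<Longrightarrow> d \<in> A \<Longrightarrow> smooth_on (snd c ` (fst c \<inter> fst d)) (snd d \<circ> chart_inv c)"
  using manifold unfolding smooth_manifold_def by blast+

lemma chart_subset: "c \<in> A \<Longrightarrow> fst c \<subseteq> topspace M"
  using cover by blast

lemma inj_on_chart: "c \<in> A \<Longrightarrow> inj_on (snd c) (fst c)"
  using homeomorphic_imp_injective_map[OF chart_homeomorphic] chart_subset
  by (simp add: Int_absorb1)

lemma chart_inv_chart [simp]: "c \<in> A \<Longrightarrow> p \<in> fst c \<Longrightarrow> chart_inv c (snd c p) = p"
  using inj_on_chart by (simp add: chart_inv_def)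

lemma open_chart_image_Int:
  assumes "c \<in> A" "openin M W"
  shows "open (snd c ` (fst c \<inter> W))"
proof -
  have "openin (subtopology M (fst c)) (fst c \<inter> W)"
    using assms(2) by (metis inf_commute openin_subtopology_Int)
  then have "openin (top_of_set (snd c ` fst c)) (snd c ` (fst c \<inter> W))"
    using homeomorphic_imp_open_map[OF chart_homeomorphic[OF assms(1)]] by (simp add: open_map_def)
  then show ?thesis
    using open_chart_image[OF assms(1)] openin_open_trans by blast
qed

lemma openin_chart_preimage:
  assumes "c \<in> A" "open T"
  shows "openin M {q \<in> fst c. snd c q \<in> T}"
proof -
  have "continuous_map (subtopology M (fst c)) euclidean (snd c)"
    using homeomorphic_imp_continuous_map[OF chart_homeomorphic[OF assms(1)]]
    by (simp add: continuous_map_in_subtopology)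
  then have "openin (subtopology M (fst c)) {q \<in> topspace (subtopology M (fst c)). snd c q \<in> T}"
    by (rule openin_continuous_map_preimage) (use assms(2) in simp)
  then show ?thesis
    using openin_trans_full[OF _ openin_chart[OF assms(1)]] chart_subset[OF assms(1)]
    by (simp add: Int_absorb1)
qed

text \<open>The coordinate map is a homeomorphism, so the preimage is compact, and compact sets are
  closed as \<open>M\<close> is Hausdorff. Closedness in \<open>M\<close>, beyond closedness in the
  chart, is what lets cut-off fields extend by zero.\<close>

lemma closedin_chart_preimage:
  assumes "c \<in> A" "compact K" "K \<subseteq> snd c ` fst c"
  shows "closedin M {q \<in> fst c. snd c q \<in> K}"
proof -
  let ?Q = "{q \<in> fst c. snd c q \<in> K}"
  have "snd c ` ?Q = K" using assms(3) by auto
  then have "compactin (top_of_set (snd c ` fst c)) (snd c ` ?Q)"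
    using assms(2,3) by (simp add: compactin_subtopology)
  moreover have "?Q \<subseteq> topspace (subtopology M (fst c))"
    using chart_subset[OF assms(1)] by auto
  ultimately have "compactin (subtopology M (fst c)) ?Q"
    using homeomorphic_map_compactness[OF chart_homeomorphic[OF assms(1)]] by blast
  then show ?thesis
    using compactin_imp_closedin[OF Hausdorff] by (simp add: compactin_subtopology)
qed

section \<open>Derivatives of coordinate changes\<close>

definition transition_derivative :: "('a, 'e) chart \<Rightarrow> ('a, 'e) chart \<Rightarrow> 'a \<Rightarrow> 'e \<Rightarrow> 'e" where
  "transition_derivative c d p = frechet_derivative (snd d \<circ> chart_inv c) (at (snd c p))"

lemma transition_has_derivative:
  assumes "c \<in> A" "d \<in> A" "p \<in> fst c" "p \<in> fst d"
  shows "((snd d \<circ> chart_inv c) has_derivative transition_derivative c d p) (at (snd c p))"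
  unfolding transition_derivative_def
  by (rule smooth_on_has_derivative[OF smooth_transition[OF assms(1,2)]]) (use assms in auto)

lemma linear_transition_derivative:
  assumes "c \<in> A" "d \<in> A" "p \<in> fst c" "p \<in> fst d"
  shows "linear (transition_derivative c d p)"
  using transition_has_derivative[OF assms] by (rule has_derivative_linear)

text \<open>A derivative depends only on the germ, so any map that agrees with the coordinate change
  near \<open>p\<close> computes it.\<close>

lemma transition_derivative_eqI:
  assumes "c \<in> A" "p \<in> fst c" "openin M W" "p \<in> W"
    and "(f has_derivative f') (at (snd c p))"
    and "\<And>q. q \<in> fst c \<Longrightarrow> q \<in> W \<Longrightarrow> f (snd c q) = snd d q"
  shows "transition_derivative c d p = f'"
proof -
  have "((snd d \<circ> chart_inv c) has_derivative f') (at (snd c p))"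
    by (rule has_derivative_transform_within_open[OF assms(5) open_chart_image_Int[OF assms(1,3)]])
       (use assms in auto)
  then show ?thesis unfolding transition_derivative_def by (rule frechet_derivative_at[symmetric])
qed

lemma transition_derivative_same:
  assumes "c \<in> A" "p \<in> fst c"
  shows "transition_derivative c c p u = u"
  using transition_derivative_eqI[OF assms openin_chart[OF assms(1)] assms(2) has_derivative_ident, of c]
  by simp

text \<open>The chain rule applies because passing from \<open>c\<close> to \<open>e\<close> through
  \<open>d\<close> is the direct coordinate change on \<open>fst c \<inter> fst d\<close>.\<close>

lemma transition_derivative_comp:
  assumes "c \<in> A" "d \<in> A" "e \<in> A" "p \<in> fst c" "p \<in> fst d" "p \<in> fst e"
  shows "transition_derivative d e p (transition_derivative c d p u) = transition_derivative c e p u"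
proof -
  have "((snd e \<circ> chart_inv d) has_derivative transition_derivative d e p)
      (at ((snd d \<circ> chart_inv c) (snd c p)))"
    using transition_has_derivative[of d e p] assms by simp
  from diff_chain_at[OF transition_has_derivative[OF assms(1,2,4,5)] this]
  have "((snd e \<circ> chart_inv d) \<circ> (snd d \<circ> chart_inv c) has_derivative
      transition_derivative d e p \<circ> transition_derivative c d p) (at (snd c p))" .
  from transition_derivative_eqI[OF assms(1,4) openin_chart[OF assms(2)] assms(5) this, of e]
  show ?thesis using assms by simp
qed

section \<open>Tangent spaces\<close>

lemma tangent_spaceI:
  assumes "\<And>c. c \<notin> A \<or> p \<notin> fst c \<Longrightarrow> v c = 0"
    and "\<And>c d. c \<in> A \<Longrightarrow> d \<in> A \<Longrightarrow> p \<in> fst c \<Longrightarrow> p \<in> fst d \<Longrightarrow>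
      v d = transition_derivative c d p (v c)"
  shows "v \<in> tangent_space A p"
  unfolding tangent_space_def transition_derivative_def[symmetric] using assms by blast

lemma tangent_space_component_0:
  "v \<in> tangent_space A p \<Longrightarrow> c \<notin> A \<or> p \<notin> fst c \<Longrightarrow> v c = 0"
  unfolding tangent_space_def by blast

lemma tangent_space_component:
  "v \<in> tangent_space A p \<Longrightarrow> c \<in> A \<Longrightarrow> d \<in> A \<Longrightarrow> p \<in> fst c \<Longrightarrow> p \<in> fst d \<Longrightarrow>
    v d = transition_derivative c d p (v c)"
  unfolding tangent_space_def transition_derivative_def by blast

lemma coord_vector_eq:
  "coord_vector A c u p = (\<lambda>d. if d \<in> A \<and> p \<in> fst d then transition_derivative c d p u else 0)"
  unfolding coord_vector_def transition_derivative_def ..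

lemma subspace_tangent_space: "subspace (tangent_space A p)"
proof (rule subspaceI)
  show "0 \<in> tangent_space A p"
    by (rule tangent_spaceI) (simp_all add: linear_0[OF linear_transition_derivative])
  show "v + w \<in> tangent_space A p" if "v \<in> tangent_space A p" "w \<in> tangent_space A p" for v w
    by (rule tangent_spaceI)
      (simp_all add: that[THEN tangent_space_component_0] linear_add[OF linear_transition_derivative]
        flip: that[THEN tangent_space_component])
  show "r *\<^sub>R v \<in> tangent_space A p" if "v \<in> tangent_space A p" for r v
    by (rule tangent_spaceI)
      (simp_all add: scaleR_fun_def tangent_space_component_0[OF that]
        linear_cmul[OF linear_transition_derivative] flip: tangent_space_component[OF that])
qed

lemma coord_vector_self: "c \<in> A \<Longrightarrow> p \<in> fst c \<Longrightarrow> coord_vector A c u p c = u"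
  by (simp add: coord_vector_eq transition_derivative_same)

lemma coord_vector_in_tangent_space:
  "c \<in> A \<Longrightarrow> p \<in> fst c \<Longrightarrow> coord_vector A c u p \<in> tangent_space A p"
  by (rule tangent_spaceI) (auto simp: coord_vector_eq transition_derivative_comp)

lemma coord_vector_component:
  assumes "v \<in> tangent_space A p" "c \<in> A" "p \<in> fst c"
  shows "coord_vector A c (v c) p = v"
proof
  show "coord_vector A c (v c) p d = v d" for d
    using tangent_space_component[OF assms(1,2) _ assms(3), of d]
      tangent_space_component_0[OF assms(1), of d]
    by (simp add: coord_vector_eq)
qed

lemma linear_coord_vector:
  assumes "c \<in> A" "p \<in> fst c"
  shows "linear (\<lambda>u. coord_vector A c u p)"
  using assms
  by (intro linearI ext) (simp_all add: coord_vector_eq scaleR_fun_def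
      linear_add[OF linear_transition_derivative] linear_cmul[OF linear_transition_derivative])

section \<open>Vector fields and cutoffs\<close>

lemma subspace_vector_fields:
  assumes "openin M W"
  shows "subspace (vector_fields A W)"
proof -
  have op: "open (snd c ` (fst c \<inter> W))" if "c \<in> A" for c
    using open_chart_image_Int[OF that assms] .
  have "smooth_on (snd c ` (fst c \<inter> W)) (\<lambda>x. r *\<^sub>R X (chart_inv c x) c)"
    if "X \<in> vector_fields A W" "c \<in> A" for r c X
    using that by (intro smooth_on_bilinear[OF bounded_bilinear_scaleR] op smooth_on_const)
      (auto simp: vector_fields_def)
  then show ?thesis
    using subspace_tangent_space op
    by (auto simp: subspace_def vector_fields_def zero_fun_def plus_fun_def scaleR_fun_def
        intro: smooth_on_const smooth_on_add)
qed

lemma vector_field_in_tangent_space: "X \<in> vector_fields A W \<Longrightarrow> X p \<in> tangent_space A p"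
  using subspace_0[OF subspace_tangent_space] by (cases "p \<in> W") (auto simp: vector_fields_def)

text \<open>Fields over \<open>W\<close> are normalised to vanish off \<open>W\<close>, so
  restriction must also reset the values there.\<close>

lemma vector_fields_restrict:
  assumes "X \<in> vector_fields A U" "openin M W" "W \<subseteq> U"
  shows "(\<lambda>p. if p \<in> W then X p else 0) \<in> vector_fields A W"
proof -
  have "smooth_on (snd c ` (fst c \<inter> W)) (\<lambda>x. (if chart_inv c x \<in> W then X (chart_inv c x) else 0) c)"
    if "c \<in> A" for c
  proof (rule smooth_on_cong[OF open_chart_image_Int[OF that assms(2)]])
    show "smooth_on (snd c ` (fst c \<inter> W)) (\<lambda>x. X (chart_inv c x) c)"
      by (rule smooth_on_subset[of "snd c ` (fst c \<inter> U)"])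
         (use assms that in \<open>auto simp: vector_fields_def\<close>)
  qed (use that in auto)
  with assms show ?thesis by (auto simp: vector_fields_def)
qed

text \<open>A coordinate field times a bump function supported in the chart extends by zero to a
  global field. As \<open>\<phi>\<close> has no zeros on \<open>W\<close> and does not depend on
  \<open>u\<close>, these fields still span every tangent space over \<open>W\<close>.\<close>

lemma cutoff_coordinate_fields:
  assumes c: "c \<in> A" and p: "p \<in> fst c"
  obtains \<phi> :: "'a \<Rightarrow> real" and W
  where "openin M W" "p \<in> W" "W \<subseteq> fst c" "\<And>q. q \<in> W \<Longrightarrow> \<phi> q \<noteq> 0"
    "\<And>u. (\<lambda>q. if q \<in> W then \<phi> q *\<^sub>R coord_vector A c u q else 0) \<in> vector_fields A (topspace M)"
proof -
  \<comment> \<open>Room for the closed ball inside the coordinate image makes \<open>K\<close>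
    closed in \<open>M\<close>.\<close>
  obtain r where r: "r > 0" "cball (snd c p) r \<subseteq> snd c ` fst c"
    using open_contains_cball[THEN iffD1, OF open_chart_image[OF c]] p by blast
  obtain \<psi> :: "'e \<Rightarrow> real" where \<psi>: "smooth_on UNIV \<psi>" "\<And>x. \<psi> x \<noteq> 0 \<longleftrightarrow> x \<in> ball (snd c p) r"
    using smooth_bump[OF r(1)] by blast
  define W where "W = {q \<in> fst c. snd c q \<in> ball (snd c p) r}"
  define K where "K = {q \<in> fst c. snd c q \<in> cball (snd c p) r}"
  have W: "openin M W" unfolding W_def by (rule openin_chart_preimage[OF c]) simp
  have K: "closedin M K"
    unfolding K_def
    by (rule closedin_chart_preimage[OF c compact_cball_of_basis[OF finite_b norm_b expand_b] r(2)])
  have WK: "W \<subseteq> K" by (auto simp: W_def K_def)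
  have Wc: "W \<subseteq> fst c" by (auto simp: W_def)
  have \<psi>0: "\<psi> (snd c q) = 0" if "q \<in> fst c" "q \<notin> W" for q
    using \<psi>(2)[of "snd c q"] that by (auto simp: W_def)
  define F where "F u q = (if q \<in> W then \<psi> (snd c q) *\<^sub>R coord_vector A c u q else 0)" for u q
  have "F u \<in> vector_fields A (topspace M)" for u
  proof -
    have "F u q \<in> tangent_space A q" for q
    proof (cases "q \<in> W")
      case True
      then show ?thesis
        using Wc c subspace_scale[OF subspace_tangent_space coord_vector_in_tangent_space[of c q]]
        by (simp add: F_def subset_iff)
    qed (simp add: F_def subspace_0[OF subspace_tangent_space])
    moreover have "F u q = 0" if "q \<notin> topspace M" for q
      using that Wc chart_subset[OF c] by (auto simp: F_def)
    moreover have "smooth_on (snd d ` (fst d \<inter> topspace M)) (\<lambda>x. F u (chart_inv d x) d)"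
      if d: "d \<in> A" for d
    proof (rule smooth_on_local)
      fix x assume "x \<in> snd d ` (fst d \<inter> topspace M)"
      then obtain q where q: "q \<in> fst d" "q \<in> topspace M" "x = snd d q" by auto
      show "\<exists>T. open T \<and> x \<in> T \<and> smooth_on T (\<lambda>x. F u (chart_inv d x) d)"
      proof (cases "q \<in> fst c")
        case True
        \<comment> \<open>Near a point of the chart \<open>c\<close> one formula serves on and off
          \<open>W\<close>, as the bump function vanishes off \<open>W\<close>. It is smooth in the
          coordinates of \<open>c\<close> and is then carried over to those of
          \<open>d\<close>.\<close>
        let ?T = "snd d ` (fst d \<inter> fst c)" and ?Tc = "snd c ` (fst c \<inter> fst d)"
        have op: "open ?T" "open ?Tc" using open_chart_image_Int c d openin_chart by auto
        have "smooth_on ?Tc (\<lambda>y. \<psi> y *\<^sub>R frechet_derivative (snd d \<circ> chart_inv c) (at y) u)"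
          by (intro smooth_on_bilinear[OF bounded_bilinear_scaleR] op smooth_on_subset[OF \<psi>(1)]
              smooth_on_frechet_derivative smooth_transition c d) auto
        then have "smooth_on ?T (\<lambda>x. \<psi> ((snd c \<circ> chart_inv d) x) *\<^sub>R
            frechet_derivative (snd d \<circ> chart_inv c) (at ((snd c \<circ> chart_inv d) x)) u)"
          by (rule smooth_on_compose[OF finite_b expand_b op(1) smooth_transition[OF d c]])
             (use c d in auto)
        then have "smooth_on ?T (\<lambda>x. F u (chart_inv d x) d)"
          by (rule smooth_on_cong[OF op(1)])
             (use c d \<psi>0 in \<open>auto simp: F_def coord_vector_def scaleR_fun_def\<close>)
        then show ?thesis using op q True by blast
      next
        case False
        \<comment> \<open>A point outside the chart \<open>c\<close> has the complement of
          \<open>K\<close> as a neighbourhood, and the field is zero there.\<close>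
        let ?T = "snd d ` (fst d \<inter> (topspace M - K))"
        have op: "open ?T" by (intro open_chart_image_Int d openin_diff openin_topspace K)
        have "smooth_on ?T (\<lambda>x. F u (chart_inv d x) d)"
          by (rule smooth_on_cong[OF op smooth_on_const[of _ 0]]) (use WK d in \<open>auto simp: F_def\<close>)
        moreover have "x \<in> ?T" using False q by (auto simp: K_def)
        ultimately show ?thesis using op by blast
      qed
    qed
    ultimately show ?thesis by (simp add: vector_fields_def)
  qed
  moreover have "p \<in> W" using p r by (simp add: W_def)
  moreover have "\<psi> (snd c q) \<noteq> 0" if "q \<in> W" for q using that \<psi>(2) by (simp add: W_def)
  ultimately show ?thesis
    using that[of W "\<lambda>q. \<psi> (snd c q)"] W Wc unfolding F_def by blast
qed

lemma vector_field_through: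
  assumes "p \<in> topspace M" "v \<in> tangent_space A p"
  obtains X where "X \<in> vector_fields A (topspace M)" "X p = v"
proof -
  obtain c where c: "c \<in> A" "p \<in> fst c" using assms(1) cover by blast
  obtain \<phi> :: "'a \<Rightarrow> real" and W
    where W: "openin M W" "p \<in> W" "W \<subseteq> fst c" "\<And>q. q \<in> W \<Longrightarrow> \<phi> q \<noteq> 0"
      "\<And>u. (\<lambda>q. if q \<in> W then \<phi> q *\<^sub>R coord_vector A c u q else 0) \<in> vector_fields A (topspace M)"
    by (rule cutoff_coordinate_fields[OF c], rule that)
  \<comment> \<open>Dividing the component by \<open>\<phi> p\<close> cancels the cutoff factor at
    \<open>p\<close>.\<close>
  let ?X = "\<lambda>q. if q \<in> W then \<phi> q *\<^sub>R coord_vector A c (v c /\<^sub>R \<phi> p) q else 0"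
  have "?X p = v"
    using W(2) W(4)[OF W(2)] coord_vector_component[OF assms(2) c]
    by (simp add: linear_cmul[OF linear_coord_vector[OF c]])
  with W(5) show ?thesis using that by blast
qed

end

section \<open>The metric and its musical isomorphisms\<close>

locale riemannian_atlas = smooth_atlas n M A b
  for n and M :: "'a topology" and A :: "('a, 'e::real_inner) chart set" and b +
  fixes g :: "'a \<Rightarrow> ('a, 'e) tvec \<Rightarrow> ('a, 'e) tvec \<Rightarrow> real"
  assumes metric: "riemannian_metric M A g"
begin

section \<open>Pointwise algebra of the metric\<close>

lemma metric_sym:
  "p \<in> topspace M \<Longrightarrow> u \<in> tangent_space A p \<Longrightarrow> v \<in> tangent_space A p \<Longrightarrow> g p u v = g p v u"
  and metric_add_left:
  "p \<in> topspace M \<Longrightarrow> u \<in> tangent_space A p \<Longrightarrow> v \<in> tangent_space A p \<Longrightarrow> w \<in> tangent_space A p \<Longrightarrow>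
    g p (u + v) w = g p u w + g p v w"
  and metric_scale_left:
  "p \<in> topspace M \<Longrightarrow> u \<in> tangent_space A p \<Longrightarrow> v \<in> tangent_space A p \<Longrightarrow>
    g p (r *\<^sub>R u) v = r * g p u v"
  and metric_pos:
  "p \<in> topspace M \<Longrightarrow> u \<in> tangent_space A p \<Longrightarrow> u \<noteq> 0 \<Longrightarrow> g p u u > 0"
  using metric unfolding riemannian_metric_def by blast+

lemma metric_smooth:
  "c \<in> A \<Longrightarrow> smooth_on (snd c ` fst c)
        (\<lambda>x. g (chart_inv c x) (coord_vector A c y (chart_inv c x))
                                (coord_vector A c z (chart_inv c x)))"
  using metric unfolding riemannian_metric_def by simp

lemmas tangent_add = subspace_add[OF subspace_tangent_space]
  and tangent_diff = subspace_diff[OF subspace_tangent_space]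
  and tangent_scale = subspace_scale[OF subspace_tangent_space]
  and tangent_0 = subspace_0[OF subspace_tangent_space]

lemma metric_add_right:
  "p \<in> topspace M \<Longrightarrow> u \<in> tangent_space A p \<Longrightarrow> v \<in> tangent_space A p \<Longrightarrow> w \<in> tangent_space A p \<Longrightarrow>
    g p w (u + v) = g p w u + g p w v"
  using metric_sym[of p w "u + v"] metric_sym[of p w u] metric_sym[of p w v]
  by (simp add: metric_add_left tangent_add)

lemma metric_scale_right:
  "p \<in> topspace M \<Longrightarrow> u \<in> tangent_space A p \<Longrightarrow> v \<in> tangent_space A p \<Longrightarrow>
    g p u (r *\<^sub>R v) = r * g p u v"
  using metric_sym[of p u "r *\<^sub>R v"] metric_sym[of p u v]
  by (simp add: metric_scale_left tangent_scale)

lemma metric_0_left: "p \<in> topspace M \<Longrightarrow> v \<in> tangent_space A p \<Longrightarrow> g p 0 v = 0"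
  using metric_scale_left[of p 0 v 0] tangent_0 by simp

lemma metric_diff_left:
  "p \<in> topspace M \<Longrightarrow> u \<in> tangent_space A p \<Longrightarrow> v \<in> tangent_space A p \<Longrightarrow> w \<in> tangent_space A p \<Longrightarrow>
    g p (u - v) w = g p u w - g p v w"
  using metric_add_left[of p "u - v" v w] by (simp add: tangent_diff)

lemma metric_diff_right:
  "p \<in> topspace M \<Longrightarrow> u \<in> tangent_space A p \<Longrightarrow> v \<in> tangent_space A p \<Longrightarrow> w \<in> tangent_space A p \<Longrightarrow>
    g p w (u - v) = g p w u - g p w v"
  using metric_add_right[of p "u - v" v w] by (simp add: tangent_diff)

text \<open>Testing with \<open>w = u - v\<close> gives \<open>g(u - v, u - v) = 0\<close>, and
  \<open>g\<close> is positive definite.\<close>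

lemma metric_eqI:
  assumes "p \<in> topspace M" "u \<in> tangent_space A p" "v \<in> tangent_space A p"
    and "\<And>w. w \<in> tangent_space A p \<Longrightarrow> g p u w = g p v w"
  shows "u = v"
  using assms metric_pos[of p "u - v"] metric_diff_left[of p u v "u - v"] tangent_diff by force

section \<open>The metric in coordinates\<close>

definition coord_metric :: "('a, 'e) chart \<Rightarrow> 'e \<Rightarrow> 'e \<Rightarrow> 'e \<Rightarrow> real" where
  "coord_metric c x u v =
     g (chart_inv c x) (coord_vector A c u (chart_inv c x)) (coord_vector A c v (chart_inv c x))"

lemma smooth_on_coord_metric:
  "c \<in> A \<Longrightarrow> S \<subseteq> snd c ` fst c \<Longrightarrow> smooth_on S (\<lambda>x. coord_metric c x u v)"
  unfolding coord_metric_def by (rule smooth_on_subset[OF metric_smooth])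

context
  fixes c x
  assumes c: "c \<in> A" and x: "x \<in> snd c ` fst c"
begin

lemma chart_inv_mem: "chart_inv c x \<in> fst c" "chart_inv c x \<in> topspace M"
  using c x chart_subset[OF c] by auto

lemma coord_metric_sym: "coord_metric c x u v = coord_metric c x v u"
  unfolding coord_metric_def
  by (intro metric_sym coord_vector_in_tangent_space chart_inv_mem c)

lemma coord_metric_pos: "u \<noteq> 0 \<Longrightarrow> coord_metric c x u u > 0"
  unfolding coord_metric_def
  using coord_vector_self[OF c chart_inv_mem(1), of u]
  by (intro metric_pos coord_vector_in_tangent_space chart_inv_mem c) auto

lemma bilinear_coord_metric: "bilinear (coord_metric c x)"
  unfolding bilinear_def coord_metric_def
  by (auto intro!: linearI simp: chart_inv_mem c metric_add_left metric_add_right metric_scale_left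
      metric_scale_right linear_add[OF linear_coord_vector] linear_cmul[OF linear_coord_vector]
      coord_vector_in_tangent_space)

end

section \<open>From vector fields to one-forms\<close>

lemma flat_in_cotangent_space:
  assumes "p \<in> topspace M" "X p \<in> tangent_space A p"
  shows "flat M A g X p \<in> cotangent_space A p"
  using assms by (auto simp: cotangent_space_def flat_def metric_add_right metric_scale_right
      tangent_add dest: tangent_scale)

text \<open>In a chart, the component along \<open>u\<close> is \<open>coord_metric\<close> applied
  to the component of \<open>X\<close> and to \<open>u\<close>, hence smooth by
  \<open>smooth_on_bilinear_form\<close>.\<close>

lemma flat_in_one_forms:
  assumes "openin M W" "X \<in> vector_fields A W"
  shows "flat M A g X \<in> one_forms A W"
proof -
  have sub: "W \<subseteq> topspace M" using assms(1) by (rule openin_subset)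
  have "flat M A g X p = 0" if "p \<notin> W" for p
  proof -
    have "X p = 0" using that assms(2) by (simp add: vector_fields_def)
    then show ?thesis by (auto simp: flat_def metric_0_left)
  qed
  moreover have "smooth_on (snd c ` (fst c \<inter> W))
      (\<lambda>x. flat M A g X (chart_inv c x) (coord_vector A c u (chart_inv c x)))"
    if c: "c \<in> A" for c u
  proof (rule smooth_on_cong)
    show op: "open (snd c ` (fst c \<inter> W))" by (rule open_chart_image_Int[OF c assms(1)])
    show "smooth_on (snd c ` (fst c \<inter> W)) (\<lambda>x. coord_metric c x (X (chart_inv c x) c) u)"
      by (rule smooth_on_bilinear_form[OF finite_b expand_b op bilinear_coord_metric[OF c]
            smooth_on_coord_metric[OF c] _ smooth_on_const])
         (use assms(2) c in \<open>auto simp: vector_fields_def\<close>)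
    fix x assume "x \<in> snd c ` (fst c \<inter> W)"
    then obtain q where "q \<in> fst c" "q \<in> W" "x = snd c q" by blast
    then show "coord_metric c x (X (chart_inv c x) c) u =
        flat M A g X (chart_inv c x) (coord_vector A c u (chart_inv c x))"
      using c sub coord_vector_in_tangent_space[OF c]
        coord_vector_component[OF vector_field_in_tangent_space[OF assms(2)] c]
      by (auto simp: coord_metric_def flat_def)
  qed
  ultimately show ?thesis
    using sub flat_in_cotangent_space vector_field_in_tangent_space[OF assms(2)]
    by (auto simp: one_forms_def)
qed

lemma flat_inject:
  assumes "X \<in> vector_fields A (topspace M)" "Y \<in> vector_fields A (topspace M)"
    and "flat M A g X = flat M A g Y"
  shows "X = Y"
proof
  fix p
  show "X p = Y p"
  proof (cases "p \<in> topspace M")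
    case True
    have "g p (X p) w = g p (Y p) w" if "w \<in> tangent_space A p" for w
      using fun_cong[OF fun_cong[OF assms(3)], of p w] True that by (simp add: flat_def)
    then show ?thesis
      using True assms(1,2)[THEN vector_field_in_tangent_space] by (intro metric_eqI)
  qed (use assms in \<open>simp add: vector_fields_def\<close>)
qed

text \<open>Injectivity of \<open>flat\<close> makes the definite description in
  \<open>sharp\<close> unique. The forms on which \<open>L_module\<close> lets \<open>B\<close> act
  are all of this kind.\<close>

lemma sharp_flat:
  assumes "X \<in> vector_fields A (topspace M)"
  shows "sharp M A g (flat M A g X) = X"
  unfolding sharp_def using assms flat_inject by (intro the_equality) auto

section \<open>Riesz representation of covectors and one-forms\<close>

lemma linear_coord_covector:
  assumes "c \<in> A" "p \<in> fst c" "\<alpha> \<in> cotangent_space A p"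
  shows "linear (\<lambda>u. \<alpha> (coord_vector A c u p))"
  using assms coord_vector_in_tangent_space[OF assms(1,2)]
  by (intro linearI) (simp_all add: cotangent_space_def linear_add[OF linear_coord_vector]
      linear_cmul[OF linear_coord_vector])

text \<open>The smooth Riesz lemma is applied in a chart around \<open>p\<close> to the family of
  functionals that is constant in \<open>x\<close>, and its solution is evaluated at
  \<open>p\<close>.\<close>

lemma covector_representation:
  assumes "p \<in> topspace M" "\<alpha> \<in> cotangent_space A p"
  obtains z where "z \<in> tangent_space A p" "\<And>v. v \<in> tangent_space A p \<Longrightarrow> g p z v = \<alpha> v"
proof -
  obtain c where c: "c \<in> A" "p \<in> fst c" using assms(1) cover by blast
  have "\<exists>Z. smooth_on (snd c ` fst c) Z \<and>
      (\<forall>x\<in>snd c ` fst c. \<forall>u. coord_metric c x (Z x) u = \<alpha> (coord_vector A c u p))"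
    by (rule smooth_riesz_representation[OF finite_b expand_b independent_b
          open_chart_image[OF c(1)] bilinear_coord_metric[OF c(1)] coord_metric_sym[OF c(1)]
          coord_metric_pos[OF c(1)] smooth_on_coord_metric[OF c(1) subset_refl]])
      (use linear_coord_covector[OF c assms(2)] smooth_on_const in auto)
  then obtain Z where Z: "coord_metric c (snd c p) (Z (snd c p)) u = \<alpha> (coord_vector A c u p)" for u
    using c by blast
  show ?thesis
  proof
    show "coord_vector A c (Z (snd c p)) p \<in> tangent_space A p"
      by (rule coord_vector_in_tangent_space[OF c])
    show "g p (coord_vector A c (Z (snd c p)) p) v = \<alpha> v" if "v \<in> tangent_space A p" for v
      using Z[of "v c"] c coord_vector_component[OF that c] by (simp add: coord_metric_def)
  qed
qed

text \<open>\<open>Z\<close> is chosen pointwise. In each chart there is also a smooth solution, and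
  uniqueness of representing vectors identifies the two, so \<open>Z\<close> is smooth.\<close>

lemma flat_surj:
  assumes \<omega>: "\<omega> \<in> one_forms A (topspace M)"
  obtains Z where "Z \<in> vector_fields A (topspace M)" "flat M A g Z = \<omega>"
proof -
  have cot: "\<omega> p \<in> cotangent_space A p" if "p \<in> topspace M" for p
    using \<omega> that by (simp add: one_forms_def)
  \<comment> \<open>Off the manifold the value 0 is the one that \<open>vector_fields\<close>
    demands.\<close>
  have "\<exists>z. (p \<in> topspace M \<longrightarrow> z \<in> tangent_space A p \<and> (\<forall>v\<in>tangent_space A p. g p z v = \<omega> p v)) \<and>
      (p \<notin> topspace M \<longrightarrow> z = 0)" for p
  proof (cases "p \<in> topspace M")
    case True
    show ?thesis by (rule covector_representation[OF True cot[OF True]]) (use True in blast)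
  qed simp
  then obtain Z where Z: "\<And>p. p \<in> topspace M \<Longrightarrow> Z p \<in> tangent_space A p"
    "\<And>p v. p \<in> topspace M \<Longrightarrow> v \<in> tangent_space A p \<Longrightarrow> g p (Z p) v = \<omega> p v"
    "\<And>p. p \<notin> topspace M \<Longrightarrow> Z p = 0"
    by metis
  have "smooth_on (snd c ` (fst c \<inter> topspace M)) (\<lambda>x. Z (chart_inv c x) c)" if c: "c \<in> A" for c
  proof -
    let ?\<alpha> = "\<lambda>x u. \<omega> (chart_inv c x) (coord_vector A c u (chart_inv c x))"
    have eq: "fst c \<inter> topspace M = fst c" using chart_subset[OF c] by blast
    have "linear (?\<alpha> x)" if "x \<in> snd c ` fst c" for x
      using chart_inv_mem[OF c that] by (intro linear_coord_covector c cot)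
    moreover have "smooth_on (snd c ` fst c) (\<lambda>x. ?\<alpha> x u)" for u
      using \<omega> c eq by (auto simp: one_forms_def)
    ultimately have "\<exists>Z. smooth_on (snd c ` fst c) Z \<and>
        (\<forall>x\<in>snd c ` fst c. \<forall>u. coord_metric c x (Z x) u = ?\<alpha> x u)"
      by (intro smooth_riesz_representation[OF finite_b expand_b independent_b
          open_chart_image[OF c] bilinear_coord_metric[OF c] coord_metric_sym[OF c]
          coord_metric_pos[OF c] smooth_on_coord_metric[OF c subset_refl]])
    then obtain Y where Y: "smooth_on (snd c ` fst c) Y"
      "\<And>x u. x \<in> snd c ` fst c \<Longrightarrow> coord_metric c x (Y x) u = ?\<alpha> x u"
      by blast
    have "Y x = Z (chart_inv c x) c" if x: "x \<in> snd c ` fst c" for x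
    proof -
      let ?q = "chart_inv c x"
      note q = chart_inv_mem[OF c x]
      have "coord_vector A c (Y x) ?q = Z ?q"
      proof (rule metric_eqI[OF q(2) coord_vector_in_tangent_space[OF c q(1)] Z(1)[OF q(2)]])
        fix w assume w: "w \<in> tangent_space A ?q"
        show "g ?q (coord_vector A c (Y x) ?q) w = g ?q (Z ?q) w"
          using Y(2)[OF x, of "w c"] Z(2)[OF q(2) w] coord_vector_component[OF w c q(1)]
          by (simp add: coord_metric_def)
      qed
      then show ?thesis using coord_vector_self[OF c q(1), of "Y x"] by simp
    qed
    then show ?thesis
      unfolding eq by (rule smooth_on_cong[OF open_chart_image[OF c] Y(1)])
  qed
  with Z(1,3) have "Z \<in> vector_fields A (topspace M)" by (simp add: vector_fields_def)
  moreover have "flat M A g Z = \<omega>"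
  proof (intro ext)
    fix p v
    show "flat M A g Z p v = \<omega> p v"
      using Z(2)[of p v] cot[of p] \<omega> by (auto simp: flat_def cotangent_space_def one_forms_def)
  qed
  ultimately show ?thesis using that by blast
qed

end

section \<open>The Dirac structure of an orthogonal automorphism\<close>

locale orthogonal_riemannian_atlas = riemannian_atlas n M A b g
  for n and M :: "'a topology" and A :: "('a, 'e::real_inner) chart set" and b and g +
  fixes B :: "('a \<Rightarrow> ('a, 'e) tvec) \<Rightarrow> 'a \<Rightarrow> ('a, 'e) tvec"
  assumes orthogonal_B: "orthogonal_automorphism M A g B"
begin

abbreviation "VF \<equiv> vector_fields A (topspace M)"

lemmas VF_add = subspace_add[OF subspace_vector_fields[OF openin_topspace]]
  and VF_diff = subspace_diff[OF subspace_vector_fields[OF openin_topspace]]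
  and VF_scale = subspace_scale[OF subspace_vector_fields[OF openin_topspace]]
  and VF_tangent = vector_field_in_tangent_space[of _ "topspace M"]

section \<open>The pointwise action of the automorphism\<close>

lemma B_image: "B ` VF = VF"
  and B_add: "X \<in> VF \<Longrightarrow> Y \<in> VF \<Longrightarrow> B (X + Y) = B X + B Y"
  and B_scale_fun: "f \<in> smooth_functions A (topspace M) \<Longrightarrow> X \<in> VF \<Longrightarrow>
    B (\<lambda>p. f p *\<^sub>R X p) = (\<lambda>p. f p *\<^sub>R B X p)"
  and B_orthogonal: "X \<in> VF \<Longrightarrow> Y \<in> VF \<Longrightarrow> p \<in> topspace M \<Longrightarrow> g p (B X p) (B Y p) = g p (X p) (Y p)"
  using orthogonal_B
  by (simp_all add: orthogonal_automorphism_def module_automorphism_def bij_betw_def)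

lemma B_VF: "X \<in> VF \<Longrightarrow> B X \<in> VF"
  using B_image by blast

lemma B_scale: "X \<in> VF \<Longrightarrow> B (r *\<^sub>R X) = r *\<^sub>R B X"
  using B_scale_fun[of "\<lambda>_. r" X]
  by (simp add: scaleR_fun_def smooth_functions_def comp_def smooth_on_const)

lemma B_diff: "X \<in> VF \<Longrightarrow> Y \<in> VF \<Longrightarrow> B (X - Y) = B X - B Y"
  using B_add[of "X - Y" Y] by (simp add: VF_diff)

text \<open>At \<open>p\<close>, \<open>B (X - Y)\<close> has the same length as
  \<open>X - Y\<close>, namely 0.\<close>

lemma B_pointwise:
  assumes "X \<in> VF" "Y \<in> VF" "X p = Y p"
  shows "B X p = B Y p"
proof (cases "p \<in> topspace M")
  case True
  have D: "X - Y \<in> VF" using assms by (intro VF_diff)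
  have "g p (B (X - Y) p) (B (X - Y) p) = 0"
    using B_orthogonal[OF D D True] assms(3) metric_0_left[OF True tangent_0] by simp
  then have "B (X - Y) p = 0"
    using metric_pos[OF True VF_tangent[OF B_VF[OF D]]] by fastforce
  then show ?thesis using assms by (simp add: B_diff)
next
  case False
  then show ?thesis using assms(1,2)[THEN B_VF] by (simp add: vector_fields_def)
qed

text \<open>Global fields enter because \<open>B\<close> acts only on those. By
  \<open>B_pointwise\<close> the element depends on \<open>X p\<close> alone, so this is the set of
  pairs formed from \<open>v + Bv\<close> and \<open>g(v - Bv, .)\<close> for tangent vectors
  \<open>v\<close>.\<close>

definition dirac_fibre :: "'a \<Rightarrow> (('a, 'e) tvec \<times> ('a, 'e) cvec) set" where
  "dirac_fibre p = {((X + B X) p, flat M A g (X - B X) p) | X. X \<in> VF}"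

lemma flat_add: "X \<in> VF \<Longrightarrow> Y \<in> VF \<Longrightarrow> flat M A g (X + Y) = flat M A g X + flat M A g Y"
  by (auto simp: flat_def fun_eq_iff metric_add_left VF_tangent)

lemma flat_scale: "X \<in> VF \<Longrightarrow> flat M A g (r *\<^sub>R X) = r *\<^sub>R flat M A g X"
  by (auto simp: flat_def fun_eq_iff metric_scale_left VF_tangent)

lemma flat_diff: "X \<in> VF \<Longrightarrow> Y \<in> VF \<Longrightarrow> flat M A g (X - Y) = flat M A g X - flat M A g Y"
  using flat_add[of "X - Y" Y] by (simp add: VF_diff)

lemma flat_cong: "X p = Y p \<Longrightarrow> flat M A g X p = flat M A g Y p"
  unfolding flat_def by (rule ext) simp

lemma flat_eq_0_iff:
  assumes "p \<in> topspace M" "X \<in> VF"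
  shows "flat M A g X p = 0 \<longleftrightarrow> X p = 0"
proof
  assume "flat M A g X p = 0"
  then have "g p (X p) (X p) = 0"
    using VF_tangent[OF assms(2), of p] assms(1)
    by (metis flat_def zero_fun_apply)
  then show "X p = 0" using metric_pos[OF assms(1) VF_tangent[OF assms(2)]] by fastforce
qed (auto simp: flat_def assms metric_0_left)

text \<open>Over \<open>W\<close>, each fibre is the image of the model space under a linear
  isomorphism \<open>F q\<close> built from the cut-off coordinate fields, so the images of
  \<open>b\<close> form a frame.\<close>

lemma dirac_frame:
  assumes p: "p \<in> topspace M"
  shows "\<exists>W X \<omega>. openin M W \<and> p \<in> W \<and>
        (\<forall>i<card b. X i \<in> vector_fields A W \<and> \<omega> i \<in> one_forms A W) \<and>
        (\<forall>q\<in>W. inj_on (\<lambda>i. (X i q, \<omega> i q)) {..<card b} \<and>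
           independent ((\<lambda>i. (X i q, \<omega> i q)) ` {..<card b}) \<and>
           span ((\<lambda>i. (X i q, \<omega> i q)) ` {..<card b}) = dirac_fibre q)"
proof -
  obtain c where c: "c \<in> A" "p \<in> fst c" using p cover by blast
  obtain \<phi> :: "'a \<Rightarrow> real" and W
    where W: "openin M W" "p \<in> W" "W \<subseteq> fst c" "\<And>q. q \<in> W \<Longrightarrow> \<phi> q \<noteq> 0"
      "\<And>u. (\<lambda>q. if q \<in> W then \<phi> q *\<^sub>R coord_vector A c u q else 0) \<in> VF"
    by (rule cutoff_coordinate_fields[OF c], rule that)
  define U where "U u q = (if q \<in> W then \<phi> q *\<^sub>R coord_vector A c u q else 0)" for u q
  have U: "U u \<in> VF" for u using W(5)[of u] by (simp add: U_def[abs_def])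
  have WM: "W \<subseteq> topspace M" using W(1) by (rule openin_subset)
  have lin: "linear (\<lambda>u. coord_vector A c u q)" if "q \<in> W" for q
    using W(3) that by (intro linear_coord_vector c) auto
  have U_add: "U (u + v) = U u + U v" for u v
    by (simp add: fun_eq_iff U_def linear_add[OF lin] scaleR_add_right)
  have U_scale: "U (r *\<^sub>R u) = r *\<^sub>R U u" for r u
    by (rule ext) (simp add: U_def linear_cmul[OF lin])
  define F where "F q u = ((U u + B (U u)) q, flat M A g (U u - B (U u)) q)" for q u
  have lin_F: "linear (F q)" for q
  proof (rule linearI)
    show "F q (u + v) = F q u + F q v" for u v
      by (simp add: F_def U_add B_add U B_VF VF_add flat_add flat_diff add_ac)
    show "F q (r *\<^sub>R u) = r *\<^sub>R F q u" for r u
      by (simp add: F_def U_scale B_scale U B_VF VF_scale flat_scale flat_diff scaleR_add_right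
          scaleR_diff_right)
  qed
  \<comment> \<open>From \<open>v + Bv = 0\<close> and \<open>v - Bv = 0\<close> follows
    \<open>2v = 0\<close>; nonvanishing of \<open>\<phi>\<close> then gives
    \<open>u = 0\<close>.\<close>
  have inj_F: "inj (F q)" if q: "q \<in> W" for q
    unfolding linear_injective_0[OF lin_F]
  proof (intro allI impI)
    fix u assume 0: "F q u = 0"
    then have "U u q + B (U u) q = 0" by (simp add: F_def prod_eq_iff)
    moreover have "(U u - B (U u)) q = 0"
      using 0 flat_eq_0_iff[of q "U u - B (U u)"] q WM U B_VF VF_diff
      by (auto simp: F_def prod_eq_iff)
    ultimately have "2 *\<^sub>R U u q = 0" by (simp add: scaleR_2)
    then have "coord_vector A c u q = 0" using q W(4) by (simp add: U_def)
    then show "u = 0" using coord_vector_self[OF c(1), of q u] q W(3) by auto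
  qed
  \<comment> \<open>Any global field agrees at \<open>q\<close> with some \<open>U u\<close>, and
    both \<open>B\<close> and \<open>flat\<close> see only the value at \<open>q\<close>.\<close>
  have range_F: "range (F q) = dirac_fibre q" if q: "q \<in> W" for q
  proof
    show "range (F q) \<subseteq> dirac_fibre q" using U by (auto simp: F_def dirac_fibre_def)
    show "dirac_fibre q \<subseteq> range (F q)"
    proof
      fix a assume "a \<in> dirac_fibre q"
      then obtain X where X: "X \<in> VF" "a = ((X + B X) q, flat M A g (X - B X) q)"
        by (auto simp: dirac_fibre_def)
      have eq: "U (X q c /\<^sub>R \<phi> q) q = X q"
        using q W(3) W(4)[OF q] coord_vector_component[OF VF_tangent[OF X(1)] c(1), of q]
        by (auto simp: U_def linear_cmul[OF lin])
      moreover have "B (U (X q c /\<^sub>R \<phi> q)) q = B X q" by (rule B_pointwise[OF U X(1) eq])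
      ultimately have "F q (X q c /\<^sub>R \<phi> q) = a" by (auto simp: F_def X(2) intro!: flat_cong)
      then show "a \<in> range (F q)" by blast
    qed
  qed
  have span_b: "span b = UNIV"
    using span_sum[of b "\<lambda>i. (u \<bullet> i) *\<^sub>R i" b for u] by (auto simp: expand_b span_scale span_base)
  obtain h where h: "bij_betw h {..<card b} b"
    using ex_bij_betw_nat_finite[OF finite_b] by (auto simp: atLeast0LessThan)
  \<comment> \<open>The global fields are cut down to \<open>W\<close>, since the frame must consist
    of sections over \<open>W\<close> that are 0 elsewhere.\<close>
  define X where "X i q = (if q \<in> W then (U (h i) + B (U (h i))) q else 0)" for i q
  define Y where "Y i q = (if q \<in> W then (U (h i) - B (U (h i))) q else 0)" for i q
  have X: "X i \<in> vector_fields A W" for i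
    unfolding X_def by (rule vector_fields_restrict[OF VF_add[OF U B_VF[OF U]] W(1) WM])
  have Y: "Y i \<in> vector_fields A W" for i
    unfolding Y_def by (rule vector_fields_restrict[OF VF_diff[OF U B_VF[OF U]] W(1) WM])
  have frame: "inj_on (\<lambda>i. (X i q, flat M A g (Y i) q)) {..<card b} \<and>
      independent ((\<lambda>i. (X i q, flat M A g (Y i) q)) ` {..<card b}) \<and>
      span ((\<lambda>i. (X i q, flat M A g (Y i) q)) ` {..<card b}) = dirac_fibre q"
    if q: "q \<in> W" for q
  proof -
    have "flat M A g (Y i) q = flat M A g (U (h i) - B (U (h i))) q" for i
      by (rule flat_cong) (simp add: Y_def q)
    then have eq: "(\<lambda>i. (X i q, flat M A g (Y i) q)) = F q \<circ> h"
      by (simp add: fun_eq_iff F_def X_def q)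
    have im: "(F q \<circ> h) ` {..<card b} = F q ` b"
      using h by (simp add: bij_betw_def flip: image_image)
    have "inj_on (F q \<circ> h) {..<card b}"
      using h inj_F[OF q] by (intro comp_inj_on) (auto simp: bij_betw_def intro: inj_on_subset)
    moreover have "independent (F q ` b)"
      by (rule linear_independent_injective_image[OF lin_F independent_b
            inj_on_subset[OF inj_F[OF q] subset_UNIV]])
    moreover have "span (F q ` b) = dirac_fibre q"
      using range_F[OF q] by (simp add: linear_span_image[OF lin_F] span_b)
    ultimately show ?thesis unfolding eq im by blast
  qed
  show ?thesis
    by (rule exI[of _ W], rule exI[of _ X], rule exI[of _ "\<lambda>i. flat M A g (Y i)"])
       (use W(1,2) X Y flat_in_one_forms frame in blast)
qed

section \<open>Maximal isotropy of the fibres\<close>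

lemma subspace_dirac_fibre:
  assumes "p \<in> topspace M"
  shows "subspace (dirac_fibre p)"
proof -
  \<comment> \<open>The fibre is the span of a local frame at \<open>p\<close>.\<close>
  obtain S where "span S = dirac_fibre p" using dirac_frame[OF assms] by blast
  then show ?thesis using subspace_span[of S] by simp
qed

lemma dirac_fibre_subset:
  assumes "p \<in> topspace M"
  shows "dirac_fibre p \<subseteq> tangent_space A p \<times> cotangent_space A p"
proof -
  have "(X + B X) p \<in> tangent_space A p" "flat M A g (X - B X) p \<in> cotangent_space A p"
    if "X \<in> VF" for X
    using VF_tangent[OF VF_add[OF that B_VF[OF that]], of p]
      flat_in_cotangent_space[of p "X - B X"] assms VF_tangent[OF VF_diff[OF that B_VF[OF that]], of p]
    by blast+
  then show ?thesis by (auto simp: dirac_fibre_def)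
qed

text \<open>In \<open>g(Y - BY, X + BX) + g(X - BX, Y + BY)\<close> the mixed terms cancel by
  symmetry. What remains is \<open>2 g(X, Y) - 2 g(BX, BY)\<close>, which vanishes by
  orthogonality.\<close>

lemma pairing_dirac_fibre:
  assumes "p \<in> topspace M" "x \<in> dirac_fibre p" "y \<in> dirac_fibre p"
  shows "pairing x y = 0"
proof -
  from assms obtain X Y where X: "X \<in> VF" "x = ((X + B X) p, flat M A g (X - B X) p)"
    and Y: "Y \<in> VF" "y = ((Y + B Y) p, flat M A g (Y - B Y) p)"
    by (auto simp: dirac_fibre_def)
  note T = VF_tangent[OF X(1), of p] VF_tangent[OF Y(1), of p]
    VF_tangent[OF B_VF[OF X(1)], of p] VF_tangent[OF B_VF[OF Y(1)], of p]
  show ?thesis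
    using T assms(1) B_orthogonal[OF X(1) Y(1) assms(1)] B_orthogonal[OF Y(1) X(1) assms(1)]
      metric_sym[OF assms(1) T(1,2)] metric_sym[OF assms(1) T(1,4)] metric_sym[OF assms(1) T(3,2)]
    by (simp add: X(2) Y(2) pairing_def flat_def tangent_add tangent_diff metric_add_left
        metric_add_right metric_diff_left metric_diff_right)
qed

text \<open>No dimension count is made: an element of a larger isotropic space annihilates the
  fibre, and this alone places it in the fibre.\<close>

lemma maximal_isotropic_dirac_fibre:
  assumes p: "p \<in> topspace M"
  shows "maximal_isotropic_at A p (dirac_fibre p)"
  unfolding maximal_isotropic_at_def
proof (intro conjI allI impI)
  show "isotropic_at A p (dirac_fibre p)"
    unfolding isotropic_at_def
    using subspace_dirac_fibre[OF p] dirac_fibre_subset[OF p] pairing_dirac_fibre[OF p] by blast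
  fix V' assume V': "isotropic_at A p V' \<and> dirac_fibre p \<subseteq> V'"
  have "a \<in> dirac_fibre p" if a: "a \<in> V'" for a
  proof -
    obtain y \<alpha> where y\<alpha>: "a = (y, \<alpha>)" by (cases a)
    have y: "y \<in> tangent_space A p" and \<alpha>: "\<alpha> \<in> cotangent_space A p"
      using V' a y\<alpha> by (auto simp: isotropic_at_def)
    obtain z where z: "z \<in> tangent_space A p" "\<And>v. v \<in> tangent_space A p \<Longrightarrow> g p z v = \<alpha> v"
      by (rule covector_representation[OF p \<alpha>], rule that)
    \<comment> \<open>This is the vanishing of the pairing with the fibre element of
      \<open>X\<close>, with the terms in \<open>X\<close> and in \<open>BX\<close> collected on
      opposite sides.\<close>
    have ann: "g p (X p) (y + z) = g p (B X p) (y - z)" if X: "X \<in> VF" for X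
    proof -
      have "pairing (y, \<alpha>) ((X + B X) p, flat M A g (X - B X) p) = 0"
        using V' a X unfolding y\<alpha> isotropic_at_def dirac_fibre_def by blast
      then have "g p (X p - B X p) y + g p z (X p + B X p) = 0"
        using z(2)[of "X p + B X p"] VF_tangent[OF X, of p] VF_tangent[OF B_VF[OF X], of p]
        by (simp add: pairing_def flat_def p y tangent_add)
      then show ?thesis
        using VF_tangent[OF X, of p] VF_tangent[OF B_VF[OF X], of p] y z(1) p
        by (simp add: metric_add_right metric_diff_left metric_diff_right metric_sym[of p z])
    qed
    have sum: "y + z \<in> tangent_space A p" and diff: "y - z \<in> tangent_space A p"
      using y z(1) by (auto intro: tangent_add tangent_diff)
    \<comment> \<open>Adding the desired equations \<open>v + Bv = y\<close> and
      \<open>v - Bv = z\<close> leaves \<open>(y + z)/2\<close> as the only candidate for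
      \<open>v\<close>.\<close>
    obtain X where X: "X \<in> VF" "X p = (1/2) *\<^sub>R (y + z)"
      by (rule vector_field_through[OF p tangent_scale[OF sum, of "1/2"]], rule that)
    have BX: "B X p = (1/2) *\<^sub>R (y - z)"
    proof (rule metric_eqI[OF p VF_tangent[OF B_VF[OF X(1)]] tangent_scale[OF diff]])
      fix s assume s: "s \<in> tangent_space A p"
      obtain Y where "Y \<in> VF" "Y p = s" by (rule vector_field_through[OF p s], rule that)
      \<comment> \<open>Surjectivity of \<open>B\<close> writes the test vector \<open>s\<close> as
        a value of \<open>B Y'\<close>, so that orthogonality and \<open>ann\<close> apply to
        \<open>Y'\<close>.\<close>
      then obtain Y' where Y': "Y' \<in> VF" "B Y' p = s" using B_image by (metis imageE)
      have t: "Y' p \<in> tangent_space A p" "B Y' p \<in> tangent_space A p"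
        using VF_tangent Y' B_VF by blast+
      have "g p (B X p) s = g p (X p) (Y' p)"
        using B_orthogonal[OF X(1) Y'(1) p] Y'(2) by simp
      also have "\<dots> = (1/2) * g p (Y' p) (y + z)"
        using t sum by (simp add: X(2) p metric_scale_left metric_sym[of p "y + z"])
      also have "\<dots> = g p ((1/2) *\<^sub>R (y - z)) s"
        using t diff ann[OF Y'(1)] Y'(2) by (simp add: p metric_scale_left metric_sym[of p "y - z"])
      finally show "g p (B X p) s = g p ((1/2) *\<^sub>R (y - z)) s" .
    qed
    \<comment> \<open>The coefficient 1 is written as \<open>1/2 + 1/2\<close> so that
      \<open>scaleR_add_left\<close> splits the right side into the halves coming from
      \<open>X\<close> and \<open>BX\<close>.\<close>
    have "X p + B X p = (1/2 + 1/2) *\<^sub>R y"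
      unfolding X(2) BX scaleR_add_left by (simp add: scaleR_add_right scaleR_diff_right)
    then have "(X + B X) p = y" by simp
    moreover have XBX: "(X - B X) p = z"
    proof -
      have "X p - B X p = (1/2 + 1/2) *\<^sub>R z"
        unfolding X(2) BX scaleR_add_left by (simp add: scaleR_add_right scaleR_diff_right)
      then show ?thesis by simp
    qed
    have "flat M A g (X - B X) p v = \<alpha> v" for v
      unfolding flat_def XBX using z(2) \<alpha> p by (simp add: cotangent_space_def)
    then have "flat M A g (X - B X) p = \<alpha>" by blast
    ultimately show ?thesis unfolding y\<alpha> dirac_fibre_def using X(1) by blast
  qed
  then show "V' = dirac_fibre p" using V' by blast
qed

section \<open>Sections of the bundle\<close>

lemma L_module_eq: "L_module M A g B = {(X + B X, flat M A g (X - B X)) | X. X \<in> VF}"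
  \<comment> \<open>By \<open>sharp_flat\<close>, the action of \<open>B\<close> on the form of
    \<open>X\<close> yields the form of \<open>B X\<close>.\<close>
  unfolding L_module_def form_action_def
  by (intro Collect_cong ex_cong1) (auto simp: sharp_flat flat_diff B_VF)

text \<open>Membership in the fibres supplies a field \<open>V\<close> for each point separately.
  The formula \<open>X = (Y + Z)/2\<close>, with \<open>Z\<close> the smooth field dual to
  \<open>\<omega>\<close>, agrees with each \<open>V\<close> at its point and so gives one smooth
  field for all of them.\<close>

lemma sections_of_dirac_fibre: "sections_of M A dirac_fibre = L_module M A g B"
  unfolding L_module_eq
proof (intro equalityI subsetI)
  fix s assume "s \<in> {(X + B X, flat M A g (X - B X)) | X. X \<in> VF}"
  then show "s \<in> sections_of M A dirac_fibre"
    by (auto simp: sections_of_def dirac_fibre_def B_VF VF_add VF_diff flat_in_one_forms)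
next
  fix s assume "s \<in> sections_of M A dirac_fibre"
  then obtain Y \<omega> where s: "s = (Y, \<omega>)" "Y \<in> VF" "\<omega> \<in> one_forms A (topspace M)"
    "\<And>p. p \<in> topspace M \<Longrightarrow> (Y p, \<omega> p) \<in> dirac_fibre p"
    by (auto simp: sections_of_def)
  obtain Z where Z: "Z \<in> VF" "flat M A g Z = \<omega>" by (rule flat_surj[OF s(3)], rule that)
  define X where "X = (1/2) *\<^sub>R (Y + Z)"
  have X: "X \<in> VF" unfolding X_def by (intro VF_scale VF_add s(2) Z(1))
  have eq: "X p + B X p = Y p \<and> X p - B X p = Z p" if p: "p \<in> topspace M" for p
  proof -
    obtain V where V: "V \<in> VF" "Y p = (V + B V) p" "\<omega> p = flat M A g (V - B V) p"
      using s(4)[OF p] by (auto simp: dirac_fibre_def)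
    have D: "Z - (V - B V) \<in> VF" using Z(1) V(1) by (intro VF_diff B_VF)
    have "flat M A g (Z - (V - B V)) p = 0"
      using Z V by (simp add: flat_diff VF_diff B_VF)
    then have Zp: "Z p = V p - B V p" using flat_eq_0_iff[OF p D] by simp
    have "X p = (1/2 + 1/2) *\<^sub>R V p"
      unfolding X_def scaleR_add_left by (simp add: V(2) Zp scaleR_add_right scaleR_diff_right)
    then have "X p = V p" by simp
    with B_pointwise[OF X V(1)] V(2) Zp show ?thesis by simp
  qed
  \<comment> \<open>Off the manifold all the fields involved are 0.\<close>
  have "X p + B X p = Y p \<and> X p - B X p = Z p" for p
    using eq[of p] X B_VF[OF X] s(2) Z(1) by (cases "p \<in> topspace M") (auto simp: vector_fields_def)
  then have "X + B X = Y" "X - B X = Z" by (auto simp: fun_eq_iff)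
  then show "s \<in> {(X + B X, flat M A g (X - B X)) | X. X \<in> VF}"
    using X Z(2) s(1) by blast
qed

lemma dirac_structure_dirac_fibre: "dirac_structure M A dirac_fibre"
  unfolding dirac_structure_def smooth_subbundle_def
  using subspace_dirac_fibre dirac_fibre_subset dirac_frame maximal_isotropic_dirac_fibre by blast

end

theorem proposition3p8:
  fixes M :: "'a topology"
    and A :: "('a, 'e::real_inner) chart set"
    and g :: "'a \<Rightarrow> ('a, 'e) tvec \<Rightarrow> ('a, 'e) tvec \<Rightarrow> real"
    and B :: "('a \<Rightarrow> ('a, 'e) tvec) \<Rightarrow> 'a \<Rightarrow> ('a, 'e) tvec"
    and n :: nat
  assumes "smooth_manifold n M A"
    and "riemannian_metric M A g"
    and "orthogonal_automorphism M A g B"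
  shows "\<exists>L. dirac_structure M A L \<and> sections_of M A L = L_module M A g B"
proof -
  obtain c :: "'e set" where c: "finite c" "span c = UNIV"
    using assms(1) unfolding smooth_manifold_def by blast
  \<comment> \<open>The basis provided by \<open>smooth_manifold\<close> is arbitrary; the
    expansions by inner products call for an orthonormal one.\<close>
  obtain b :: "'e set"
    where b: "finite b" "\<And>i. i \<in> b \<Longrightarrow> norm i = 1" "\<And>x. (\<Sum>i\<in>b. (x \<bullet> i) *\<^sub>R i) = x" "independent b"
    by (rule orthonormal_basis_exists[OF c], rule that)
  interpret orthogonal_riemannian_atlas n M A b g B
    by unfold_locales (fact assms b)+
  show ?thesis using dirac_structure_dirac_fibre sections_of_dirac_fibre by blast
qed

end
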